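(* Let $F\subset\mathbb{R}^d$ be a self-similar set that is the attractor of an IFS $\mathcal S$, and assume $F$ is not contained in any $(d-1)$-dimensional hyperplane. Then for any vector subspace $V$ of $V_{\mathcal S}$ we have $$\dim_A F=\dim V+\dim_{A}\pi_{V^{\perp}}(F).$$ In particular, $$\dim_A F=\dim_O F+\dim_A \pi_{V_{\mathcal O}^{\perp}}(F).$$ Moreover, for any vector subspace $V$ of $V_{\mathcal S}$, the strict inequality $\dim V<\dim_A F$ holds whenever $\dim V<d$.
   Context: IFS and attractor: an IFS is a finite family $\mathcal S=\{S_1,\dots,S_m\}$ of contractive similitudes of $\mathbb{R}^d$, $S_i(x)=c_iO_ix+b_i$ with $c_i\in(0,1)$, $O_i$ a $d\times d$ orthogonal matrix, $b_i\in\mathbb{R}^d$. Its attractor is the unique nonempty compact $F$ with $F=\bigcup_{i=1}^m S_i(F)$; such an $F$ is called a self-similar set. $\mathcal I=\{1,\dots,m\}$, $\mathcal I^\ast=\bigcup_{k\ge1}\mathcal I^k$, and for $\alpha=(i_1,\dots,i_k)\in\mathcal I^\ast$, $S_\alpha=S_{i_1}\circ\cdots\circ S_{i_k}$. Assouad dimension: $N_r(E)$ is the minimum number of closed balls of radius $r$ needed to cover $E$, $B(x,R)$ is the closed ball, and $\dim_A E$ is the infimum of the $\alpha$ for which there is a constant $c$ such that $\sup_{x\in E}N_r(B(x,R)\cap E)\le c(R/r)^\alpha$ for all $0<r<R$. Weak separation property (WSP): let $\mathcal E=\{S_\alpha^{-1}\circ S_\beta:\alpha,\beta\in\mathcal I^\ast,\alpha\ne\beta\}$,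 inside the group of similitudes with the topology of pointwise convergence. For $F$ not contained in any $(d-1)$-dimensional hyperplane, $\mathcal S$ satisfies the WSP if $I\notin\overline{\mathcal E\setminus\{I\}}$, where $I$ is the identity. Overlapping directions: $\|\cdot\|_\infty$ is the sup norm on $[0,1]^d$ and $\|\cdot\|_{\mathrm{op}}$ the Euclidean operator norm. Suppose $\mathcal S$ does not satisfy the WSP and $F$ is not contained in any $(d-1)$-dimensional hyperplane. Take any sequences $\alpha_k,\beta_k\in\mathcal I^\ast$ such that $\Phi_k:=S_{\alpha_k}^{-1}\circ S_{\beta_k}-I$ satisfies $0<\|\Phi_k\|_\infty\to0$ and such that, for some $a\in F$ and $\rho>0$, $\rho\|D\Phi_k\|_{\mathrm{op}}\le\|\Phi_k(a_k)\|$ for all $k$, where $a_k$ is any point of $B(a,\rho)$ minimizing $\|\Phi_k(x)\|$ over $x\in B(a,\rho)$. Any limit point $\omega\in S^{d-1}$ of $\{\Phi_k(a)/\|\Phi_k(a)\|\}_k$, for any such choice of data, is called an overlapping direction for $\mathcal S$. $V_{\mathcal S}$ is the vector subspace of $\mathbb{R}^d$ spanned by all overlapping directions for $\mathcal S$. If $\mathcal S$ satisfies the WSP, $V_{\mathcal S}=\{0\}$. $V_{\mathcal O}$ and overlapping dimension: among all IFSs $\mathcal S$ with attractor $F$ choose one for which $\dim V_{\mathcal S}$ is maximal; the subspace $V_{\mathcal S}$ does not depend on the choice (a union of two IFSs generating $F$ is again an IFS generating $F$), and it is denoted $V_{\mathcal O}$. Set $\dim_O F=\dim V_{\mathcal O}$.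 $\pi_V:\mathbb{R}^d\to V$ denotes the orthogonal projection onto the subspace $V$. *)

theory Defs
  imports "HOL-Analysis.Analysis"
begin

section \<open>Iterated function systems\<close>

definition contractive_similitude :: "(real^'n \<Rightarrow> real^'n) \<Rightarrow> bool" where
  "contractive_similitude f \<longleftrightarrow>
     (\<exists>c A b. 0 < c \<and> c < 1 \<and> orthogonal_matrix A \<and> (\<forall>x. f x = c *\<^sub>R (A *v x) + b))"

text \<open>A family \<open>S\<^sub>1, \<dots>, S\<^sub>m\<close> is a list of maps, so repeated maps are allowed and
  the index set is \<open>{..<length S}\<close>. The empty list is harmless: it has no attractor.\<close>

definition ifs :: "(real^'n \<Rightarrow> real^'n) list \<Rightarrow> bool" where
  "ifs S \<longleftrightarrow> (\<forall>f\<in>set S. contractive_similitude f)"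

definition attractor_of :: "(real^'n) set \<Rightarrow> (real^'n \<Rightarrow> real^'n) list \<Rightarrow> bool" where
  "attractor_of F S \<longleftrightarrow> compact F \<and> F \<noteq> {} \<and> F = (\<Union>i<length S. (S ! i) ` F)"

definition words :: "(real^'n \<Rightarrow> real^'n) list \<Rightarrow> nat list set" where
  "words S = {\<alpha>. \<alpha> \<noteq> [] \<and> set \<alpha> \<subseteq> {..<length S}}"

definition word_map :: "(real^'n \<Rightarrow> real^'n) list \<Rightarrow> nat list \<Rightarrow> (real^'n \<Rightarrow> real^'n)" where
  "word_map S \<alpha> = foldr (\<lambda>i g. (S ! i) \<circ> g) \<alpha> id"

definition in_hyperplane :: "(real^'n) set \<Rightarrow> bool" where
  "in_hyperplane F \<longleftrightarrow> (\<exists>H. affine H \<and> aff_dim H = int CARD('n) - 1 \<and> F \<subseteq> H)"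

section \<open>Assouad dimension\<close>

text \<open>Used only for bounded \<open>E\<close> and \<open>r > 0\<close>, where a finite cover exists.\<close>

definition covering_number :: "real \<Rightarrow> (real^'n) set \<Rightarrow> nat" where
  "covering_number r E =
     (LEAST N. \<exists>C. finite C \<and> card C = N \<and> E \<subseteq> (\<Union>x\<in>C. cball x r))"

text \<open>For nonempty \<open>E\<close> the restriction \<open>0 \<le> s\<close> changes nothing, since the covering
  numbers of \<open>cball x R \<inter> E\<close> are at least 1; it makes the infimum well defined for
  \<open>E = {}\<close>, too.\<close>

definition assouad_dim :: "(real^'n) set \<Rightarrow> real" where
  "assouad_dim E =
     Inf {s. 0 \<le> s \<and> (\<exists>c. \<forall>r R. 0 < r \<and> r < R \<longrightarrow>
            (\<forall>x\<in>E. real (covering_number r (cball x R \<inter> E)) \<le> c * (R / r) powr s))}"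

section \<open>Weak separation property\<close>

definition neighbour_maps :: "(real^'n \<Rightarrow> real^'n) list \<Rightarrow> (real^'n \<Rightarrow> real^'n) set" where
  "neighbour_maps S =
     {inv (word_map S \<alpha>) \<circ> word_map S \<beta> | \<alpha> \<beta>. \<alpha> \<in> words S \<and> \<beta> \<in> words S \<and> \<alpha> \<noteq> \<beta>}"

text \<open>The topology on a function type is the product topology, i.e. pointwise
  convergence. As the identity is a similitude, taking the closure in the space of all
  maps or in the group of similitudes makes no difference.\<close>

definition weak_separation :: "(real^'n \<Rightarrow> real^'n) list \<Rightarrow> bool" where
  "weak_separation S \<longleftrightarrow> id \<notin> closure (neighbour_maps S - {id})"

section \<open>Overlapping directions\<close>

definition diff_map ::
    "(real^'n \<Rightarrow> real^'n) list \<Rightarrow> nat list \<Rightarrow> nat list \<Rightarrow> (real^'n \<Rightarrow> real^'n)" where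
  "diff_map S \<alpha> \<beta> = (\<lambda>x. inv (word_map S \<alpha>) (word_map S \<beta> x) - x)"

definition cube_sup_norm :: "(real^'n \<Rightarrow> real^'n) \<Rightarrow> real" where
  "cube_sup_norm f = (SUP x\<in>cbox 0 1. norm (f x))"

text \<open>The maps \<open>diff_map S \<alpha> \<beta>\<close> are affine, so their derivative does not depend on the
  base point. The minimiser \<open>p k\<close> only enters through the minimal value. A limit point
  of the sequence of directions is the limit of a subsequence (a cluster point of the
  sequence, not an accumulation point of its range).\<close>

definition overlapping_direction ::
    "(real^'n \<Rightarrow> real^'n) list \<Rightarrow> (real^'n) set \<Rightarrow> real^'n \<Rightarrow> bool" where
  "overlapping_direction S F \<omega> \<longleftrightarrow>
     (\<exists>\<alpha> \<beta> a \<rho> p. let \<Phi> = (\<lambda>k::nat. diff_map S (\<alpha> k) (\<beta> k)) in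
        (\<forall>k. \<alpha> k \<in> words S \<and> \<beta> k \<in> words S) \<and>
        (\<forall>k. 0 < cube_sup_norm (\<Phi> k)) \<and>
        (\<lambda>k. cube_sup_norm (\<Phi> k)) \<longlonglongrightarrow> 0 \<and>
        a \<in> F \<and> 0 < \<rho> \<and>
        (\<forall>k. p k \<in> cball a \<rho> \<and> (\<forall>x\<in>cball a \<rho>. norm (\<Phi> k (p k)) \<le> norm (\<Phi> k x))) \<and>
        (\<forall>k. \<rho> * onorm (frechet_derivative (\<Phi> k) (at a)) \<le> norm (\<Phi> k (p k))) \<and>
        \<omega> \<in> sphere 0 1 \<and>
        (\<exists>\<sigma>. strict_mono \<sigma> \<and>
           (\<lambda>j. \<Phi> (\<sigma> j) a /\<^sub>R norm (\<Phi> (\<sigma> j) a)) \<longlonglongrightarrow> \<omega>))"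

definition overlap_space ::
    "(real^'n \<Rightarrow> real^'n) list \<Rightarrow> (real^'n) set \<Rightarrow> (real^'n) set" where
  "overlap_space S F =
     (if weak_separation S then {0} else span {\<omega>. overlapping_direction S F \<omega>})"

text \<open>The maximum exists because \<open>dim\<close> is bounded by \<open>CARD('n)\<close>.\<close>

definition max_overlap_space :: "(real^'n) set \<Rightarrow> (real^'n) set" where
  "max_overlap_space F =
     overlap_space (ARG_MAX (\<lambda>S. dim (overlap_space S F)) S. ifs S \<and> attractor_of F S) F"

definition overlap_dim :: "(real^'n) set \<Rightarrow> nat" where
  "overlap_dim F = dim (max_overlap_space F)"

section \<open>Orthogonal projection\<close>

definition orth_proj :: "(real^'n) set \<Rightarrow> real^'n \<Rightarrow> real^'n" where
  "orth_proj V x = (THE y. y \<in> V \<and> (\<forall>v\<in>V. orthogonal (x - y) v))"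

end

theory Submission
  imports Defs
begin

text \<open>
  The bound \<open>\<le>\<close> holds for every set: cover the projection to \<open>V\<^sup>\<bottom>\<close> and multiply with a grid of \<open>V\<close>.
  For \<open>\<ge>\<close>, an overlapping direction \<open>\<omega>\<close> yields word maps \<open>g\<close>, \<open>h\<close> such that \<open>g\<inverse>h\<close> is nearly a
  translation by a small multiple of \<open>\<omega>\<close>, so \<open>g\<inverse>(F)\<close> contains \<open>F\<close> and a slightly shifted copy of it.
  Iterating along a basis of overlapping directions, one finds magnified copies of \<open>F\<close> that come
  arbitrarily close to every point of a translate of \<open>B\<^sub>V(0,R) + \<pi>(F)\<close>, where \<open>\<pi>\<close> is the projection
  to \<open>V\<^sup>\<bottom>\<close>. Counting separated points in this product set bounds the dimension from below.
  For the strict inequality, \<open>F\<close> has positive width in every direction, uniformly over its subcopies,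
  so every nontrivial projection of \<open>F\<close> contains a binary tree of points separated at a geometric rate.
\<close>

section \<open>Similitudes\<close>

text \<open>The obstacle in the lower bound is that overlaps come at uncontrolled scales and that
  magnifying by \<open>g\<inverse>\<close> also rotates. Both are met by letting the step length
  vary: any \<open>t\<close> between \<open>\<kappa> * \<epsilon>\<close> and
  \<open>\<epsilon>\<close> will do, because the error of a step is proportional to its length. The
  total error is then about \<epsilon> plus a multiple of \<eta> times the distance travelled,
  whatever the number of steps, and the lower bound \<open>\<kappa> * \<epsilon>\<close> makes
  finitely many steps enough. Word maps send F into itself, so the copies can be chosen to grow and
  nothing reached earlier is lost. A point of F also has a component in V; a translation within V
  cancels it, which turns translates of F into a true product with \<open>\<pi>(F)\<close>.
  Admissible constants in the Assouad dimension depend on R and r only through \<open>R / r\<close>,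
  so they pass unchanged from F to its magnified copies. Everything is done for single exponents: s
  for the projection gives \<open>dim V + s\<close> for F, and s for F gives
  \<open>s - dim V\<close> for the projection.\<close>

definition similitude :: "real \<Rightarrow> ('a::euclidean_space \<Rightarrow> 'a) \<Rightarrow> ('a \<Rightarrow> 'a) \<Rightarrow> bool" where
  "similitude c Q g \<longleftrightarrow>
     0 < c \<and> orthogonal_transformation Q \<and> (\<forall>x y. g x - g y = c *\<^sub>R Q (x - y))"

lemma similitude_id: "similitude 1 id id"
  by (simp add: similitude_def id_def)

lemma similitude_compose:
  assumes "similitude c Q f" "similitude d R g"
  shows "similitude (c * d) (Q \<circ> R) (f \<circ> g)"
  using assms
  by (auto simp: similitude_def orthogonal_transformation_compose orthogonal_transformation_scaleR)

lemma similitude_funpow: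
  assumes "similitude c Q g"
  shows "similitude (c ^ n) (Q ^^ n) (g ^^ n)"
  using assms by (induction n) (auto simp: similitude_id intro: similitude_compose)

lemma similitude_norm:
  assumes "similitude c Q g"
  shows "norm (g x - g y) = c * norm (x - y)"
  using assms by (auto simp: similitude_def orthogonal_transformation_norm)

lemma similitude_bij:
  assumes "similitude c Q g"
  shows "bij g"
proof (rule bijI)
  have c: "0 < c" and Q: "orthogonal_transformation Q"
    using assms by (auto simp: similitude_def)
  show "inj g"
    using similitude_norm[OF assms] c by (intro injI) (metis eq_iff_diff_eq_0 mult_eq_0_iff norm_eq_zero order_less_irrefl)
  show "surj g"
    unfolding surj_def
  proof
    fix y
    obtain u where u: "Q u = (1 / c) *\<^sub>R (y - g 0)"
      using orthogonal_transformation_surj[OF Q] by (metis surjD)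
    have "g u - g 0 = c *\<^sub>R Q (u - 0)"
      using assms by (simp add: similitude_def del: diff_zero)
    also have "\<dots> = y - g 0"
      using u c by simp
    finally show "\<exists>x. y = g x" by (metis diff_add_cancel)
  qed
qed

lemma similitude_inv:
  assumes "similitude c Q g"
  shows "similitude (1 / c) (inv Q) (inv g)"
proof -
  have c: "0 < c" and Q: "orthogonal_transformation Q"
    using assms by (auto simp: similitude_def)
  have bij: "bij g" by (rule similitude_bij[OF assms])
  have bijQ: "bij Q" by (rule orthogonal_transformation_bij[OF Q])
  have "inv g x - inv g y = (1 / c) *\<^sub>R inv Q (x - y)" for x y
  proof -
    have "x - y = g (inv g x) - g (inv g y)"
      using bij by (simp add: bij_is_surj surj_f_inv_f)
    also have "\<dots> = c *\<^sub>R Q (inv g x - inv g y)"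
      using assms by (simp add: similitude_def)
    also have "\<dots> = Q (c *\<^sub>R (inv g x - inv g y))"
      using Q by (simp add: orthogonal_transformation_scaleR)
    finally have "inv Q (x - y) = c *\<^sub>R (inv g x - inv g y)"
      using bijQ by (simp add: bij_is_inj inv_f_f)
    then show ?thesis using c by simp
  qed
  then show ?thesis
    using c Q by (simp add: similitude_def orthogonal_transformation_inv)
qed

text \<open>The powers of Q lie in the unit ball of a finite-dimensional operator space, so finitely
  many balls of radius \<eta> around powers \<open>Q ^^ i\<close> cover them all. If
  \<open>Q ^^ m\<close> is close to \<open>Q ^^ i\<close>, cancelling the isometry
  \<open>Q ^^ i\<close> puts \<open>Q ^^ (m - i)\<close> close to the identity, and m - i misses m
  by at most the largest such i.\<close>

lemma orthogonal_transformation_recurrent: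
  fixes Q :: "'a::euclidean_space \<Rightarrow> 'a"
  assumes Q: "orthogonal_transformation Q" and "0 < \<eta>"
  obtains N where "\<And>m. \<exists>n\<le>m. m \<le> n + N \<and> (\<forall>x. norm ((Q ^^ n) x - x) \<le> \<eta> * norm x)"
proof -
  have orth: "orthogonal_transformation (Q ^^ n)" for n
  proof (induction n)
    case (Suc n)
    show ?case
      using orthogonal_transformation_compose[OF Q Suc] by (simp add: o_def)
  qed (simp add: id_def)
  define B where "B n = Blinfun (Q ^^ n)" for n
  have app: "blinfun_apply (B n) = Q ^^ n" for n
    unfolding B_def
    by (rule bounded_linear_Blinfun_apply)
      (simp add: linear_conv_bounded_linear[symmetric] orthogonal_transformation_linear orth)
  have "norm (B n) \<le> 1" for n
    by (rule norm_blinfun_bound) (auto simp: app orthogonal_transformation_norm[OF orth])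
  then have "bounded (range B)"
    by (auto simp: bounded_iff)
  then have "compact (closure (range B))"
    by (simp add: compact_closure)
  moreover have "closure (range B) \<subseteq> (\<Union>n\<in>UNIV. ball (B n) \<eta>)"
    using \<open>0 < \<eta>\<close> by (auto simp: closure_approachable)
  ultimately obtain C where C: "finite C" "closure (range B) \<subseteq> (\<Union>n\<in>C. ball (B n) \<eta>)"
    by (metis compactE_image open_ball)
  define N where "N = Max (insert 0 C)"
  have "\<exists>n\<le>m. m \<le> n + N \<and> (\<forall>x. norm ((Q ^^ n) x - x) \<le> \<eta> * norm x)" for m
  proof (cases "m \<le> N")
    case True
    then show ?thesis using \<open>0 < \<eta>\<close> by (intro exI[of _ 0]) auto
  next
    case False
    have "B m \<in> closure (range B)" by (rule subsetD[OF closure_subset]) simp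
    then obtain i where i: "i \<in> C" "dist (B i) (B m) < \<eta>" using C by auto
    then have "i \<le> N" using C by (simp add: N_def)
    have "norm ((Q ^^ (m - i)) x - x) \<le> \<eta> * norm x" for x
    proof -
      have "(Q ^^ m) x = (Q ^^ i) ((Q ^^ (m - i)) x)"
        using False \<open>i \<le> N\<close> by (metis comp_apply funpow_add le_add_diff_inverse less_imp_le not_le order_trans)
      then have "norm ((Q ^^ (m - i)) x - x) = norm ((Q ^^ m) x - (Q ^^ i) x)"
        using orthogonal_transformation_norm[OF orth[of i]]
          linear_diff[OF orthogonal_transformation_linear[OF orth[of i]]] by metis
      also have "\<dots> = norm (blinfun_apply (B m - B i) x)"
        by (simp add: blinfun.diff_left app)
      also have "\<dots> \<le> norm (B m - B i) * norm x" by (rule norm_blinfun)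
      also have "\<dots> \<le> \<eta> * norm x"
        using i by (intro mult_right_mono) (auto simp: dist_norm norm_minus_commute)
      finally show ?thesis .
    qed
    then show ?thesis
      using False \<open>i \<le> N\<close> by (intro exI[of _ "m - i"]) auto
  qed
  then show thesis using that by blast
qed

section \<open>The semigroup of an iterated function system\<close>

definition ifs_maps :: "(real^'n \<Rightarrow> real^'n) list \<Rightarrow> (real^'n \<Rightarrow> real^'n) set" where
  "ifs_maps S = word_map S ` {\<alpha>. set \<alpha> \<subseteq> {..<length S}}"

lemma word_map_Cons: "word_map S (i # \<alpha>) = S ! i \<circ> word_map S \<alpha>"
  by (simp add: word_map_def o_def)

lemma word_map_append: "word_map S (\<alpha> @ \<beta>) = word_map S \<alpha> \<circ> word_map S \<beta>"
  by (induction \<alpha>) (auto simp: word_map_def)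

lemma ifs_maps_id: "id \<in> ifs_maps S"
  unfolding ifs_maps_def by (rule image_eqI[of _ _ "[]"]) (auto simp: word_map_def)

lemma ifs_maps_compose: "f \<in> ifs_maps S \<Longrightarrow> g \<in> ifs_maps S \<Longrightarrow> f \<circ> g \<in> ifs_maps S"
  unfolding ifs_maps_def
  by (auto simp: word_map_append[symmetric] intro!: imageI)

lemma ifs_maps_funpow: "g \<in> ifs_maps S \<Longrightarrow> g ^^ n \<in> ifs_maps S"
  by (induction n) (auto intro: ifs_maps_id ifs_maps_compose)

lemma ifs_maps_word: "\<alpha> \<in> words S \<Longrightarrow> word_map S \<alpha> \<in> ifs_maps S"
  by (auto simp: ifs_maps_def words_def)

lemma ifs_maps_nth: "i < length S \<Longrightarrow> S ! i \<in> ifs_maps S"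
  unfolding ifs_maps_def by (rule image_eqI[of _ _ "[i]"]) (auto simp: word_map_def)

lemma ifs_maps_induct [consumes 1, case_names id nth]:
  assumes "g \<in> ifs_maps S" and "P id"
    and "\<And>i h. i < length S \<Longrightarrow> h \<in> ifs_maps S \<Longrightarrow> P h \<Longrightarrow> P (S ! i \<circ> h)"
  shows "P g"
proof -
  have "P (word_map S \<alpha>)" if "set \<alpha> \<subseteq> {..<length S}" for \<alpha>
    using that
  proof (induction \<alpha>)
    case (Cons i \<alpha>)
    then show ?case
      unfolding word_map_Cons by (intro assms(3)) (auto simp: ifs_maps_def)
  qed (use assms in \<open>simp add: word_map_def id_def\<close>)
  then show ?thesis using assms(1) by (auto simp: ifs_maps_def)
qed

lemma contractive_similitude_imp_similitude:
  assumes "contractive_similitude f"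
  obtains c Q where "similitude c Q f" "c < 1"
proof -
  obtain c A b where *: "0 < c" "c < 1" "orthogonal_matrix A" "\<And>x. f x = c *\<^sub>R (A *v x) + b"
    using assms by (auto simp: contractive_similitude_def)
  have "similitude c ((*v) A) f"
    using * by (auto simp: similitude_def orthogonal_transformation_matrix
      algebra_simps matrix_vector_mult_diff_distrib)
  then show thesis using that * by blast
qed

lemma ifs_maps_similitude:
  assumes "ifs S" "g \<in> ifs_maps S"
  obtains c Q where "similitude c Q g"
proof -
  have "\<exists>c Q. similitude c Q g"
    using assms(2)
  proof (induction rule: ifs_maps_induct)
    case id
    then show ?case using similitude_id by blast
  next
    case (nth i h)
    then obtain c Q where "similitude c Q h" by blast
    moreover obtain d R where "similitude d R (S ! i)"
      using assms(1) nth contractive_similitude_imp_similitude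
      by (metis ifs_def nth_mem)
    ultimately show ?case using similitude_compose by blast
  qed
  then show thesis using that by blast
qed

lemma ifs_maps_image_subset:
  assumes "attractor_of F S" "g \<in> ifs_maps S"
  shows "g ` F \<subseteq> F"
  using assms(2)
proof (induction rule: ifs_maps_induct)
  case (nth i h)
  have "(S ! i) ` F \<subseteq> F"
    using nth assms(1) by (auto simp: attractor_of_def)
  then show ?case using nth by (auto simp: image_comp[symmetric])
qed auto

text \<open>Following an address of a to depth k gives a copy of F around a with ratio between
  \<open>lo ^ k\<close> and \<open>hi ^ k\<close>. The depth depends only on \<mu>, so
  \<open>lo ^ k\<close> serves all points of F at once.\<close>

lemma ifs_maps_ratio:
  assumes "ifs S" "attractor_of F S" "0 < \<mu>"
  obtains \<kappa> where "0 < \<kappa>"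
    "\<And>a. a \<in> F \<Longrightarrow> \<exists>g c Q. g \<in> ifs_maps S \<and> similitude c Q g \<and> a \<in> g ` F \<and> \<kappa> \<le> c \<and> c \<le> \<mu>"
proof -
  have "\<forall>i\<in>{..<length S}. \<exists>c Q. similitude c Q (S ! i) \<and> c < 1"
    using assms(1) contractive_similitude_imp_similitude by (metis ifs_def lessThan_iff nth_mem)
  then obtain c Q where cQ: "\<And>i. i < length S \<Longrightarrow> similitude (c i) (Q i) (S ! i) \<and> c i < 1"
    by (metis lessThan_iff)
  define I where "I = {..<length S}"
  have I: "finite I" "I \<noteq> {}"
    using assms(2) by (auto simp: I_def attractor_of_def)
  define lo where "lo = Min (c ` I)"
  define hi where "hi = Max (c ` I)"
  have c: "lo \<le> c i" "c i \<le> hi" if "i < length S" for i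
    using that I by (auto simp: lo_def hi_def I_def)
  have lo: "0 < lo"
    using I cQ by (auto simp: lo_def I_def similitude_def)
  have hi: "0 < hi" "hi < 1"
  proof -
    show "hi < 1" using I cQ by (auto simp: hi_def I_def)
    show "0 < hi" using lo c I by (fastforce simp: I_def)
  qed
  have level: "\<exists>g d R. g \<in> ifs_maps S \<and> similitude d R g \<and> a \<in> g ` F \<and> lo ^ k \<le> d \<and> d \<le> hi ^ k"
    if "a \<in> F" for a k
    using that
  proof (induction k arbitrary: a)
    case 0
    then show ?case
      by (intro exI[of _ id] exI[of _ "1 :: real"] conjI) (rule ifs_maps_id similitude_id | simp)+
  next
    case (Suc k)
    have "a \<in> (\<Union>i<length S. (S ! i) ` F)"
      using assms(2) Suc.prems unfolding attractor_of_def by blast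
    then obtain i b where i: "i < length S" "b \<in> F" "a = (S ! i) b" by blast
    from Suc.IH[OF i(2)] obtain g d R where g: "g \<in> ifs_maps S" "similitude d R g" "b \<in> g ` F"
      "lo ^ k \<le> d" "d \<le> hi ^ k" by blast
    have "S ! i \<circ> g \<in> ifs_maps S"
      using i g ifs_maps_compose ifs_maps_nth by blast
    moreover have "similitude (c i * d) (Q i \<circ> R) (S ! i \<circ> g)"
      using cQ[OF i(1)] g similitude_compose by blast
    moreover have "a \<in> (S ! i \<circ> g) ` F"
      using i g by auto
    moreover have "lo ^ Suc k \<le> c i * d" "c i * d \<le> hi ^ Suc k"
      using c[OF i(1)] g lo hi by (auto intro!: mult_mono intro: order_trans[OF zero_le_power g(4)])
    ultimately show ?case by blast
  qed
  obtain k where "hi ^ k < \<mu>"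
    using hi assms(3) real_arch_pow_inv by blast
  then show thesis
    using that[of "lo ^ k"] level[of _ k] lo by (meson order_trans less_imp_le zero_less_power)
qed

lemma bounded_norm_diff_le:
  fixes F :: "'a::real_normed_vector set"
  assumes "bounded F"
  obtains M where "0 < M" "\<And>x y. x \<in> F \<Longrightarrow> y \<in> F \<Longrightarrow> norm (x - y) \<le> M"
proof -
  obtain K where K: "\<And>x. x \<in> F \<Longrightarrow> norm x \<le> K" using assms by (auto simp: bounded_iff)
  have "norm (x - y) \<le> 2 * \<bar>K\<bar> + 1" if "x \<in> F" "y \<in> F" for x y
    using K[OF that(1)] K[OF that(2)] norm_triangle_ineq4[of x y] by linarith
  then show thesis using that[of "2 * \<bar>K\<bar> + 1"] by simp
qed

section \<open>Small translations along overlapping directions\<close>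

text \<open>\<open>g\<inverse>\<close> divides a translation by c and turns it by
  \<open>Q\<inverse>\<close>. Comparing \<open>Q\<inverse>(y - x)\<close> with
  \<open>t *\<^sub>R \<omega>\<close> after applying the isometry Q brings in only
  \<open>norm (Q \<omega> - \<omega>)\<close>, so the relative error grows from \<theta> to \<theta>
  + \<eta> however small c is.\<close>

lemma similitude_inv_shift:
  assumes g: "similitude c Q g" and \<omega>: "norm (Q \<omega> - \<omega>) \<le> \<eta>" and "0 \<le> t"
    and y: "norm (y - x - t *\<^sub>R \<omega>) \<le> \<theta> * t"
  shows "norm (inv g y - inv g x - (t / c) *\<^sub>R \<omega>) \<le> (\<theta> + \<eta>) * (t / c)"
proof -
  have c: "0 < c" and Q: "orthogonal_transformation Q" using g by (auto simp: similitude_def)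
  define w where "w = inv Q (y - x)"
  have w: "Q w = y - x"
    unfolding w_def using Q by (simp add: orthogonal_transformation_surj surj_f_inv_f)
  have "norm (w - t *\<^sub>R \<omega>) = norm (Q w - Q (t *\<^sub>R \<omega>))"
    using orthogonal_transformation_norm[OF Q] linear_diff[OF orthogonal_transformation_linear[OF Q]]
    by metis
  also have "\<dots> = norm ((y - x - t *\<^sub>R \<omega>) - t *\<^sub>R (Q \<omega> - \<omega>))"
    unfolding w using Q by (simp add: orthogonal_transformation_scaleR algebra_simps)
  also have "\<dots> \<le> \<theta> * t + t * \<eta>"
    using norm_triangle_ineq4[of "y - x - t *\<^sub>R \<omega>" "t *\<^sub>R (Q \<omega> - \<omega>)"] y
      mult_left_mono[OF \<omega> \<open>0 \<le> t\<close>] \<open>0 \<le> t\<close> by simp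
  finally have "norm (w - t *\<^sub>R \<omega>) / c \<le> (\<theta> * t + t * \<eta>) / c"
    using c by (intro divide_right_mono) auto
  moreover have "inv g y - inv g x - (t / c) *\<^sub>R \<omega> = (1 / c) *\<^sub>R (w - t *\<^sub>R \<omega>)"
    using similitude_inv[OF g] by (simp add: similitude_def w_def algebra_simps)
  moreover have "norm ((1 / c) *\<^sub>R (w - t *\<^sub>R \<omega>)) = norm (w - t *\<^sub>R \<omega>) / c"
    using c by simp
  moreover have "(\<theta> * t + t * \<eta>) / c = (\<theta> + \<eta>) * (t / c)"
    by (simp add: algebra_simps)
  ultimately show ?thesis by metis
qed

text \<open>The word maps \<open>g\<close>, \<open>h\<close> give \<open>g\<inverse>(F) \<supseteq> F \<union> g\<inverse>h(F)\<close>, and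
  \<open>g\<inverse>h\<close> is nearly a translation by \<open>t\<omega>\<close>. The point is that \<open>\<kappa>\<close> may depend on the
  precision \<open>\<eta>\<close> but not on the scale \<open>\<epsilon>\<close>.\<close>

definition drift :: "(real^'n \<Rightarrow> real^'n) list \<Rightarrow> (real^'n) set \<Rightarrow> real^'n \<Rightarrow> bool" where
  "drift S F \<omega> \<longleftrightarrow>
     (\<forall>\<eta>>0. \<exists>\<kappa>>0. \<forall>\<epsilon>>0. \<exists>g\<in>ifs_maps S. \<exists>h\<in>ifs_maps S. \<exists>t. \<kappa> * \<epsilon> \<le> t \<and> t \<le> \<epsilon> \<and>
        (\<forall>x\<in>F. norm (inv g (h x) - x - t *\<^sub>R \<omega>) \<le> \<eta> * t))"

text \<open>The size of \<open>\<Phi> = g\<inverse>h - id\<close> is only known to tend to zero; to reach a prescribed scale,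
  conjugate by \<open>v\<^sup>n\<close>, where \<open>v(F)\<close> is so close to \<open>a\<close> that \<open>\<Phi>\<close> is almost constant on it. This
  magnifies \<open>\<Phi>(a)\<close> by \<open>c\<close>\<open>\<^sup>-\<^sup>n\<close> and rotates it by \<open>Q\<^sup>-\<^sup>n\<close>, and the exponents with \<open>Q\<^sup>n\<close> near
  the identity have bounded gaps.\<close>

lemma drift_if_small_differences:
  fixes S :: "(real^'n \<Rightarrow> real^'n) list"
  assumes ifs: "ifs S" and F: "attractor_of F S"
    and g: "\<And>j::nat. g j \<in> ifs_maps S" and h: "\<And>j. h j \<in> ifs_maps S"
    and a: "a \<in> F" and "0 < \<rho>" and "norm \<omega> = 1"
    and lip: "\<And>j x. \<rho> * norm (inv (g j) (h j x) - x - (inv (g j) (h j a) - a))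
                 \<le> norm (inv (g j) (h j a) - a) * norm (x - a)"
    and lim0: "(\<lambda>j. inv (g j) (h j a) - a) \<longlonglongrightarrow> 0"
    and dir: "(\<lambda>j. (inv (g j) (h j a) - a) /\<^sub>R norm (inv (g j) (h j a) - a)) \<longlonglongrightarrow> \<omega>"
  shows "drift S F \<omega>"
  unfolding drift_def
proof (intro allI impI)
  fix \<eta> :: real assume "0 < \<eta>"
  \<comment> \<open>One third each for the variation of \<Phi> on \<open>V(F)\<close>, the direction
    of \<open>\<Phi> a\<close>, and the rotation by \<open>Q ^^ n\<close>.\<close>
  define \<eta>' where "\<eta>' = \<eta> / 3"
  have \<eta>': "0 < \<eta>'" "\<eta>' + \<eta>' + \<eta>' = \<eta>" using \<open>0 < \<eta>\<close> by (auto simp: \<eta>'_def)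
  have "bounded F" using F by (simp add: attractor_of_def compact_imp_bounded)
  obtain D where D: "0 < D" "\<And>x y. x \<in> F \<Longrightarrow> y \<in> F \<Longrightarrow> norm (x - y) \<le> D"
    using bounded_norm_diff_le[OF \<open>bounded F\<close>] by blast
  \<comment> \<open>The copy \<open>v(F)\<close> gets diameter at most
    \<open>\<eta>' * \<rho>\<close>, so by \<open>lip\<close> the values of \<Phi> on it differ from
    \<open>\<Phi> a\<close> by at most \<open>\<eta>' * norm (\<Phi> a)\<close>.\<close>
  define \<mu> where "\<mu> = min (1/2) (\<eta>' * \<rho> / D)"
  have \<mu>: "0 < \<mu>" "\<mu> < 1" "\<mu> * D \<le> \<eta>' * \<rho>"
  proof -
    have "\<mu> * D \<le> \<eta>' * \<rho> / D * D"
      unfolding \<mu>_def using D(1) by (intro mult_right_mono) auto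
    then show "\<mu> * D \<le> \<eta>' * \<rho>" using D(1) by simp
  qed (use \<eta>' D(1) \<open>0 < \<rho>\<close> in \<open>auto simp: \<mu>_def\<close>)
  obtain v c Q where v: "v \<in> ifs_maps S" "similitude c Q v" "a \<in> v ` F" "c \<le> \<mu>"
    using ifs_maps_ratio[OF ifs F \<mu>(1)] a by metis
  have c: "0 < c" "c < 1" and Q: "orthogonal_transformation Q"
    using v \<mu> by (auto simp: similitude_def)
  obtain N where N: "\<And>m. \<exists>n\<le>m. m \<le> n + N \<and> (\<forall>x. norm ((Q ^^ n) x - x) \<le> \<eta>' * norm x)"
    using orthogonal_transformation_recurrent[OF Q \<eta>'(1)] by blast
  have "\<exists>u\<in>ifs_maps S. \<exists>w\<in>ifs_maps S. \<exists>t. c ^ Suc N * \<epsilon> \<le> t \<and> t \<le> \<epsilon> \<and>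
        (\<forall>x\<in>F. norm (inv u (w x) - x - t *\<^sub>R \<omega>) \<le> \<eta> * t)" if \<epsilon>: "0 < \<epsilon>" for \<epsilon>
  proof -
    \<comment> \<open>The first threshold leaves room for at least N + 1 magnifications before the
      scale \<epsilon> is reached. The second keeps the normalised vector at distance below 1 from
      the unit vector \<omega>; this excludes \<open>\<Phi> a = 0\<close>, which would normalise to
      0.\<close>
    have pos: "0 < min (\<epsilon> * c ^ Suc N) 1" "0 < min \<eta>' 1" using \<epsilon> c \<eta>' by auto
    have "\<forall>\<^sub>F j in sequentially. norm (inv (g j) (h j a) - a) < \<epsilon> * c ^ Suc N \<and>
        dist ((inv (g j) (h j a) - a) /\<^sub>R norm (inv (g j) (h j a) - a)) \<omega> < min \<eta>' 1"
      using tendstoD[OF lim0 pos(1)] tendstoD[OF dir pos(2)] by eventually_elim auto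
    then obtain j where j: "norm (inv (g j) (h j a) - a) < \<epsilon> * c ^ Suc N"
        "dist ((inv (g j) (h j a) - a) /\<^sub>R norm (inv (g j) (h j a) - a)) \<omega> < min \<eta>' 1"
      by (auto simp: eventually_sequentially)
    define \<Phi> where "\<Phi> x = inv (g j) (h j x) - x" for x
    define \<tau> where "\<tau> = norm (\<Phi> a)"
    have \<tau>: "0 < \<tau>"
    proof (rule ccontr)
      assume "\<not> 0 < \<tau>"
      then have "\<Phi> a = 0" by (simp add: \<tau>_def)
      then show False using j(2) \<open>norm \<omega> = 1\<close> by (simp add: \<Phi>_def dist_norm)
    qed
    have \<tau>\<omega>: "norm (\<Phi> a - \<tau> *\<^sub>R \<omega>) \<le> \<eta>' * \<tau>"
    proof -
      have "\<Phi> a - \<tau> *\<^sub>R \<omega> = \<tau> *\<^sub>R (\<Phi> a /\<^sub>R \<tau> - \<omega>)"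
        using \<tau> by (simp add: algebra_simps)
      then have "norm (\<Phi> a - \<tau> *\<^sub>R \<omega>) = \<tau> * norm (\<Phi> a /\<^sub>R \<tau> - \<omega>)"
        using \<tau> by simp
      also have "\<dots> \<le> \<tau> * \<eta>'"
        using j(2) \<tau> unfolding \<Phi>_def \<tau>_def dist_norm by (intro mult_left_mono) auto
      finally show ?thesis by (simp add: mult.commute)
    qed
    \<comment> \<open>The largest m with \<open>\<tau> / c ^ m \<le> \<epsilon>\<close>. A recurrent
      exponent n lies between m - N and m, so \<open>\<tau> / c ^ n\<close> stays below \<epsilon>
      but above \<open>c ^ Suc N * \<epsilon>\<close>. Neither v nor N depends on \<epsilon>, hence
      \<open>c ^ Suc N\<close> can serve as \<kappa>.\<close>
    define m where "m = (GREATEST m. \<tau> / \<epsilon> \<le> c ^ m)"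
    obtain b where b: "c ^ b < \<tau> / \<epsilon>"
      using real_arch_pow_inv[of "\<tau> / \<epsilon>" c] \<tau> \<epsilon> c by auto
    have bound: "\<forall>k. \<tau> / \<epsilon> \<le> c ^ k \<longrightarrow> k \<le> b"
    proof (intro allI impI)
      fix k assume "\<tau> / \<epsilon> \<le> c ^ k"
      then have "c ^ b < c ^ k" using b by simp
      then show "k \<le> b" using c by (meson less_imp_le linorder_not_less nat_le_linear power_decreasing)
    qed
    have "\<tau> / \<epsilon> \<le> c ^ Suc N" using j(1) \<epsilon> by (simp add: \<tau>_def \<Phi>_def field_simps)
    then have m1: "Suc N \<le> m" "\<tau> / \<epsilon> \<le> c ^ m"
      unfolding m_def using bound
      Greatest_le_nat[of "\<lambda>m. \<tau> / \<epsilon> \<le> c ^ m" "Suc N" b]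
      GreatestI_nat[of "\<lambda>m. \<tau> / \<epsilon> \<le> c ^ m" "Suc N" b] by simp_all
    have m2: "c ^ Suc m < \<tau> / \<epsilon>"
      using bound Greatest_le_nat[of "\<lambda>m. \<tau> / \<epsilon> \<le> c ^ m" "Suc m" b]
      unfolding m_def[symmetric] by (meson Suc_n_not_le_n not_le)
    obtain n where n: "n \<le> m" "m \<le> n + N" "\<And>x. norm ((Q ^^ n) x - x) \<le> \<eta>' * norm x"
      using N by blast
    \<comment> \<open>At least one factor v is what places \<open>V(F)\<close> inside
      \<open>v(F)\<close>, and thus near a.\<close>
    have "1 \<le> n" using m1 n by simp
    define t where "t = \<tau> / c ^ n"
    have "0 < t" using \<tau> c by (simp add: t_def)
    have t1: "t \<le> \<epsilon>"
    proof -
      have "\<tau> / \<epsilon> \<le> c ^ n"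
        using m1(2) n(1) c by (meson less_imp_le order_trans power_decreasing)
      then show ?thesis using c \<epsilon> by (simp add: t_def field_simps)
    qed
    have t2: "c ^ Suc N * \<epsilon> \<le> t"
    proof -
      have "c ^ Suc N * c ^ n \<le> c ^ Suc m"
        using n(2) c unfolding power_add[symmetric] by (intro power_decreasing) auto
      also have "\<dots> \<le> \<tau> / \<epsilon>" using m2 by simp
      finally show ?thesis using c \<epsilon> by (simp add: t_def field_simps)
    qed
    define V where "V = v ^^ n"
    have V: "similitude (c ^ n) (Q ^^ n) V"
      unfolding V_def by (rule similitude_funpow[OF v(2)])
    have VS: "V \<in> ifs_maps S" unfolding V_def by (rule ifs_maps_funpow[OF v(1)])
    have near: "norm (V x - a) \<le> \<eta>' * \<rho>" if "x \<in> F" for x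
    proof -
      have "v ^^ n = v \<circ> v ^^ (n - 1)" using \<open>1 \<le> n\<close> by (cases n) auto
      moreover have "(v ^^ (n - 1)) x \<in> F"
        using ifs_maps_image_subset[OF F ifs_maps_funpow[OF v(1)]] that by blast
      ultimately obtain y where y: "y \<in> F" "V x = v y" by (auto simp: V_def)
      obtain z where z: "z \<in> F" "a = v z" using v(3) by auto
      have "norm (V x - a) = c * norm (y - z)"
        using y z similitude_norm[OF v(2)] by simp
      also have "\<dots> \<le> \<mu> * D"
        using v(4) c D y z \<mu> by (intro mult_mono) auto
      finally show ?thesis using \<mu>(3) by linarith
    qed
    have "norm (inv (g j \<circ> V) ((h j \<circ> V) x) - x - t *\<^sub>R \<omega>) \<le> \<eta> * t" if x: "x \<in> F" for x
    proof -
      have gj: "bij (g j)" using ifs_maps_similitude[OF ifs g] similitude_bij by metis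
      have bijV: "bij V" using V by (rule similitude_bij)
      have "inv (g j \<circ> V) ((h j \<circ> V) x) = inv V (inv (g j) (h j (V x)))"
        using gj bijV by (simp add: o_inv_distrib)
      then have eq: "inv (g j \<circ> V) ((h j \<circ> V) x) - x = inv V (V x + \<Phi> (V x)) - inv V (V x)"
        using bijV by (simp add: \<Phi>_def bij_is_inj)
      have "\<rho> * norm (\<Phi> (V x) - \<Phi> a) \<le> \<tau> * norm (V x - a)"
        using lip[of j "V x"] by (simp add: \<Phi>_def \<tau>_def)
      also have "\<dots> \<le> \<tau> * (\<eta>' * \<rho>)"
        using near[OF x] \<tau> by (intro mult_left_mono) auto
      finally have 3: "norm (\<Phi> (V x) - \<Phi> a) \<le> \<eta>' * \<tau>"
        using \<open>0 < \<rho>\<close> by (simp add: mult_ac)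
      have "V x + \<Phi> (V x) - V x - \<tau> *\<^sub>R \<omega> = (\<Phi> (V x) - \<Phi> a) + (\<Phi> a - \<tau> *\<^sub>R \<omega>)"
        by simp
      then have "norm (V x + \<Phi> (V x) - V x - \<tau> *\<^sub>R \<omega>) = norm ((\<Phi> (V x) - \<Phi> a) + (\<Phi> a - \<tau> *\<^sub>R \<omega>))"
        by (rule arg_cong)
      also have "\<dots> \<le> (\<eta>' + \<eta>') * \<tau>"
        unfolding distrib_right by (rule norm_triangle_mono[OF 3 \<tau>\<omega>])
      finally have "norm (V x + \<Phi> (V x) - V x - \<tau> *\<^sub>R \<omega>) \<le> (\<eta>' + \<eta>') * \<tau>" .
      moreover have "norm ((Q ^^ n) \<omega> - \<omega>) \<le> \<eta>'"
        using n(3)[of \<omega>] \<open>norm \<omega> = 1\<close> by simp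
      ultimately have "norm (inv V (V x + \<Phi> (V x)) - inv V (V x) - (\<tau> / c ^ n) *\<^sub>R \<omega>)
          \<le> (\<eta>' + \<eta>' + \<eta>') * (\<tau> / c ^ n)"
        using similitude_inv_shift[OF V _ less_imp_le[OF \<tau>]] by blast
      then show ?thesis by (simp only: eq t_def \<eta>'(2))
    qed
    moreover have "g j \<circ> V \<in> ifs_maps S" "h j \<circ> V \<in> ifs_maps S"
      using VS g h by (simp_all add: ifs_maps_compose)
    ultimately show ?thesis
      using t1 t2 by blast
  qed
  then show "\<exists>\<kappa>>0. \<forall>\<epsilon>>0. \<exists>g\<in>ifs_maps S. \<exists>h\<in>ifs_maps S. \<exists>t. \<kappa> * \<epsilon> \<le> t \<and> t \<le> \<epsilon> \<and>
        (\<forall>x\<in>F. norm (inv g (h x) - x - t *\<^sub>R \<omega>) \<le> \<eta> * t)"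
    using c by (intro exI[of _ "c ^ Suc N"]) (auto simp del: power_Suc)
qed

text \<open>As a lies in the ball, the condition on the minimiser bounds \<open>\<rho>\<close> times
  the norm of the linear part by \<open>norm (\<Phi> k a)\<close>: each difference map varies slowly
  compared with its own size at a, as \<open>drift_if_small_differences\<close> requires. The sup
  norm controls only the unit cube, where a need not lie; but the cube contains 0 and the standard
  basis, which determine an affine map, so \<open>\<Phi> k a\<close> tends to 0 as well.\<close>

lemma drift_if_overlapping_direction:
  fixes S :: "(real^'n \<Rightarrow> real^'n) list"
  assumes ifs: "ifs S" and F: "attractor_of F S" and od: "overlapping_direction S F \<omega>"
  shows "drift S F \<omega>"
proof -
  obtain \<alpha> \<beta> :: "nat \<Rightarrow> nat list" and a :: "real^'n" and \<rho> :: real and p :: "nat \<Rightarrow> real^'n"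
    and \<sigma> :: "nat \<Rightarrow> nat"
    where words: "\<And>k. \<alpha> k \<in> words S" "\<And>k. \<beta> k \<in> words S"
      and lim: "(\<lambda>k. cube_sup_norm (diff_map S (\<alpha> k) (\<beta> k))) \<longlonglongrightarrow> 0"
      and a: "a \<in> F" and \<rho>: "0 < \<rho>"
      and p: "\<And>k x. x \<in> cball a \<rho> \<Longrightarrow>
        norm (diff_map S (\<alpha> k) (\<beta> k) (p k)) \<le> norm (diff_map S (\<alpha> k) (\<beta> k) x)"
      and der: "\<And>k. \<rho> * onorm (frechet_derivative (diff_map S (\<alpha> k) (\<beta> k)) (at a))
        \<le> norm (diff_map S (\<alpha> k) (\<beta> k) (p k))"
      and \<omega>: "\<omega> \<in> sphere 0 1" and \<sigma>: "strict_mono \<sigma>"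
      and dir: "(\<lambda>j. diff_map S (\<alpha> (\<sigma> j)) (\<beta> (\<sigma> j)) a
          /\<^sub>R norm (diff_map S (\<alpha> (\<sigma> j)) (\<beta> (\<sigma> j)) a)) \<longlonglongrightarrow> \<omega>"
    using od unfolding overlapping_direction_def Let_def by blast
  define \<Phi> where "\<Phi> k = diff_map S (\<alpha> k) (\<beta> k)" for k
  have \<Phi>: "\<Phi> k x = inv (word_map S (\<alpha> k)) (word_map S (\<beta> k) x) - x" for k x
    by (simp add: \<Phi>_def diff_map_def)
  have "\<exists>L. linear L \<and> (\<forall>x y. \<Phi> k x - \<Phi> k y = L (x - y))" for k
  proof -
    obtain c Q d R where cQ: "similitude c Q (word_map S (\<alpha> k))" "similitude d R (word_map S (\<beta> k))"
      using ifs_maps_similitude[OF ifs] words ifs_maps_word by metis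
    define c' Q' where "c' = 1 / c * d" and "Q' = inv Q \<circ> R"
    have sim: "similitude c' Q' (inv (word_map S (\<alpha> k)) \<circ> word_map S (\<beta> k))"
      unfolding c'_def Q'_def using cQ similitude_inv similitude_compose by blast
    then have "linear (\<lambda>x. c' *\<^sub>R Q' x - x)"
      by (metis linear_compose_sub linear_compose_scale_right orthogonal_transformation_linear
          linear_ident similitude_def)
    moreover have "\<Phi> k x - \<Phi> k y = c' *\<^sub>R Q' (x - y) - (x - y)" for x y
      using sim by (simp add: \<Phi> similitude_def algebra_simps)
    ultimately show ?thesis by (intro exI[of _ "\<lambda>x. c' *\<^sub>R Q' x - x"]) auto
  qed
  then obtain L where L: "\<And>k. linear (L k)" "\<And>k x y. \<Phi> k x - \<Phi> k y = L k (x - y)"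
    by metis
  have \<Phi>_eq: "\<Phi> k x = L k x + \<Phi> k 0" for k x
    using L(2)[of k x 0] by (simp add: algebra_simps)
  have "(\<Phi> k has_derivative L k) (at a)" for k
  proof -
    have "((\<lambda>x. L k x + \<Phi> k 0) has_derivative L k) (at a)"
      by (rule has_derivative_add_const[OF linear_imp_has_derivative[OF L(1)]])
    moreover have "\<Phi> k = (\<lambda>x. L k x + \<Phi> k 0)" by (rule ext) (rule \<Phi>_eq)
    ultimately show ?thesis by metis
  qed
  then have fd: "frechet_derivative (\<Phi> k) (at a) = L k" for k
    by (metis frechet_derivative_at)
  have blin: "bounded_linear (L k)" for k
    using L(1) by (simp add: linear_conv_bounded_linear)
  have lip: "\<rho> * norm (\<Phi> k x - \<Phi> k a) \<le> norm (\<Phi> k a) * norm (x - a)" for k x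
  proof -
    have "\<rho> * norm (\<Phi> k x - \<Phi> k a) \<le> \<rho> * (onorm (L k) * norm (x - a))"
      unfolding L(2) using onorm[OF blin] \<rho> by (intro mult_left_mono) auto
    also have "\<dots> = (\<rho> * onorm (L k)) * norm (x - a)" by simp
    also have "\<dots> \<le> norm (\<Phi> k a) * norm (x - a)"
    proof (rule mult_right_mono)
      have "\<rho> * onorm (L k) \<le> norm (\<Phi> k (p k))"
        using der[of k] fd[of k] by (simp add: \<Phi>_def)
      also have "\<dots> \<le> norm (\<Phi> k a)"
        using p[of a k] \<rho> by (simp add: \<Phi>_def)
      finally show "\<rho> * onorm (L k) \<le> norm (\<Phi> k a)" .
    qed simp
    finally show ?thesis .
  qed
  have cube: "(\<lambda>k. \<Phi> k x) \<longlonglongrightarrow> 0" if "x \<in> cbox 0 1" for x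
  proof (rule Lim_null_comparison[OF _ lim])
    have "norm (\<Phi> k x) \<le> cube_sup_norm (diff_map S (\<alpha> k) (\<beta> k))" for k
    proof -
      have "continuous_on (cbox 0 1) (\<lambda>x. norm (L k x + \<Phi> k 0))"
        by (intro continuous_intros linear_continuous_on blin)
      then have "compact ((\<lambda>x. norm (\<Phi> k x)) ` cbox 0 1)"
        using \<Phi>_eq[of k, symmetric] compact_cbox by (simp add: compact_continuous_image)
      then have "bdd_above ((\<lambda>x. norm (\<Phi> k x)) ` cbox 0 1)"
        by (simp add: bounded_imp_bdd_above compact_imp_bounded)
      then show ?thesis
        unfolding cube_sup_norm_def \<Phi>_def using that by (intro cSUP_upper) auto
    qed
    then show "\<forall>\<^sub>F k in sequentially. norm (\<Phi> k x) \<le> cube_sup_norm (diff_map S (\<alpha> k) (\<beta> k))"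
      by simp
  qed
  have basis: "(\<lambda>k. L k b) \<longlonglongrightarrow> 0" if "b \<in> Basis" for b
  proof -
    have "(0::real^'n) \<in> cbox 0 1" "b \<in> cbox 0 1"
      using that by (auto simp: mem_box_cart Basis_vec_def axis_def)
    then have "(\<lambda>k. \<Phi> k b - \<Phi> k 0) \<longlonglongrightarrow> 0 - 0"
      by (intro tendsto_diff cube)
    then show ?thesis by (simp add: L(2))
  qed
  have lim0: "(\<lambda>k. \<Phi> k a) \<longlonglongrightarrow> 0"
  proof -
    have "L k a = (\<Sum>b\<in>Basis. (a \<bullet> b) *\<^sub>R L k b)" for k
      using linear_sum[OF L(1), of k "\<lambda>b. (a \<bullet> b) *\<^sub>R b" Basis]
      by (simp add: euclidean_representation linear_cmul[OF L(1)])
    moreover have "(\<lambda>k. (\<Sum>b\<in>Basis. (a \<bullet> b) *\<^sub>R L k b) + \<Phi> k 0)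
        \<longlonglongrightarrow> (\<Sum>b\<in>Basis. (a \<bullet> b) *\<^sub>R 0) + 0"
      by (intro tendsto_intros basis cube) (auto simp: mem_box_cart)
    ultimately show ?thesis by (simp add: \<Phi>_eq[of _ a])
  qed
  show ?thesis
  proof (rule drift_if_small_differences[OF ifs F])
    show "(\<lambda>j. inv (word_map S (\<alpha> (\<sigma> j))) (word_map S (\<beta> (\<sigma> j)) a) - a) \<longlonglongrightarrow> 0"
      using LIMSEQ_subseq_LIMSEQ[OF lim0 \<sigma>] by (simp add: o_def \<Phi>)
  qed (use words ifs_maps_word a \<rho> \<omega> lip dir in \<open>auto simp: \<Phi> diff_map_def\<close>)
qed

section \<open>Product structure inside magnified copies of the attractor\<close>

text \<open>A one-sided form of weak tangent: E must lie near a magnified copy of F but need not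
  fill it, and g may depend on \<delta>. This suffices for lower bounds, since separated points of E
  remain separated after a small perturbation.\<close>

definition approximable :: "(real^'n \<Rightarrow> real^'n) list \<Rightarrow> (real^'n) set \<Rightarrow> (real^'n) set \<Rightarrow> bool" where
  "approximable S F E \<longleftrightarrow>
     (\<forall>\<delta>>0. \<exists>g\<in>ifs_maps S. \<forall>z\<in>E. \<exists>x\<in>F. norm (inv g x - z) \<le> \<delta>)"

lemma approximable_self: "approximable S F F"
  unfolding approximable_def
proof (intro allI impI bexI[OF _ ifs_maps_id] ballI)
  fix \<delta> :: real and z assume "0 < \<delta>" "z \<in> F"
  then show "\<exists>x\<in>F. norm (inv id x - z) \<le> \<delta>" by (intro bexI[of _ z]) simp_all
qed

lemma approximable_mono: "approximable S F E \<Longrightarrow> E' \<subseteq> E \<Longrightarrow> approximable S F E'"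
  unfolding approximable_def by blast

text \<open>Replacing \<open>g\<close> by a power only enlarges \<open>g\<inverse>(F)\<close>, and a suitable power has almost no rotation;
  hence magnifying a small translation by \<open>g\<inverse>\<close> does not change its direction.\<close>

lemma approximable_extend_step:
  fixes S :: "(real^'n \<Rightarrow> real^'n) list"
  assumes ifs: "ifs S" and F: "attractor_of F S" and g: "g \<in> ifs_maps S" and "norm \<omega> = 1" and "0 < \<eta>"
    and drift: "\<And>\<epsilon>. 0 < \<epsilon> \<Longrightarrow> \<exists>u\<in>ifs_maps S. \<exists>h\<in>ifs_maps S. \<exists>t. \<kappa> * \<epsilon> \<le> t \<and> t \<le> \<epsilon> \<and>
        (\<forall>x\<in>F. norm (inv u (h x) - x - t *\<^sub>R \<omega>) \<le> \<eta> * t)"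
    and "0 < \<epsilon>" and "0 < \<kappa>"
  obtains g' s where "g' \<in> ifs_maps S" "\<kappa> * \<epsilon> \<le> s" "s \<le> \<epsilon>" "inv g ` F \<subseteq> inv g' ` F"
    "\<And>z. z \<in> inv g ` F \<Longrightarrow> \<exists>x\<in>F. norm (inv g' x - z - s *\<^sub>R \<omega>) \<le> (\<eta> + \<eta>) * s"
proof -
  obtain c Q where cQ: "similitude c Q g" using ifs_maps_similitude[OF ifs g] .
  have Q: "orthogonal_transformation Q" using cQ by (simp add: similitude_def)
  obtain N where "\<And>m. \<exists>n\<le>m. m \<le> n + N \<and> (\<forall>x. norm ((Q ^^ n) x - x) \<le> \<eta> * norm x)"
    using orthogonal_transformation_recurrent[OF Q \<open>0 < \<eta>\<close>] by blast
  \<comment> \<open>The value \<open>Suc N\<close> forces \<open>1 \<le> n\<close>; for n = 0 the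
    map G would be the identity and \<open>G\<inverse>(F)\<close> might miss points of
    \<open>g\<inverse>(F)\<close>.\<close>
  from this[of "Suc N"] obtain n where n: "Suc N \<le> n + N" "\<And>x. norm ((Q ^^ n) x - x) \<le> \<eta> * norm x"
    by blast
  define G where "G = g ^^ n"
  have G: "similitude (c ^ n) (Q ^^ n) G" unfolding G_def by (rule similitude_funpow[OF cQ])
  have GS: "G \<in> ifs_maps S" unfolding G_def by (rule ifs_maps_funpow[OF g])
  have c: "0 < c ^ n" using G by (simp add: similitude_def)
  have bij: "bij g" "bij G" using cQ G similitude_bij by blast+
  have sub1: "inv g ` F \<subseteq> inv G ` F"
  proof
    fix z assume "z \<in> inv g ` F"
    then obtain x where x: "x \<in> F" "z = inv g x" by blast
    have "g z = x" using x bij by (simp add: bij_is_surj surj_f_inv_f)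
    then have "G z = (g ^^ (n - 1)) x"
      using n(1) unfolding G_def by (cases n) (auto simp: funpow_swap1)
    moreover have "(g ^^ (n - 1)) x \<in> F"
      using ifs_maps_image_subset[OF F ifs_maps_funpow[OF g]] x(1) by blast
    ultimately have "G z \<in> F" by metis
    then show "z \<in> inv G ` F" using bij by (metis bij_is_inj image_eqI inv_f_f)
  qed
  \<comment> \<open>The drift is requested at a scale smaller by \<open>c ^ n\<close>, because
    \<open>G\<inverse>\<close> magnifies it back by that factor.\<close>
  have "0 < \<epsilon> * c ^ n" using \<open>0 < \<epsilon>\<close> c by simp
  from drift[OF this] obtain u h t where u: "u \<in> ifs_maps S" and h: "h \<in> ifs_maps S"
    and t: "\<kappa> * (\<epsilon> * c ^ n) \<le> t" "t \<le> \<epsilon> * c ^ n"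
    and uh: "\<And>x. x \<in> F \<Longrightarrow> norm (inv u (h x) - x - t *\<^sub>R \<omega>) \<le> \<eta> * t" by blast
  \<comment> \<open>\<open>u\<inverse>(F)\<close> contains F, as u maps F into itself, and also the
    shifted points \<open>u\<inverse>(h x)\<close>. Applying \<open>G\<inverse>\<close> puts the old
    points and their translates into one copy \<open>g'\<inverse>(F)\<close>.\<close>
  define g' s where "g' = u \<circ> G" and "s = t / c ^ n"
  have "bij u" using ifs_maps_similitude[OF ifs u] similitude_bij by metis
  then have inv_g': "inv g' x = inv G (inv u x)" for x
    unfolding g'_def using bij by (simp add: o_inv_distrib)
  have "0 \<le> t" using t \<open>0 < \<epsilon>\<close> \<open>0 < \<kappa>\<close> c by (meson less_imp_le mult_nonneg_nonneg order_trans)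
  show thesis
  proof
    show "g' \<in> ifs_maps S" unfolding g'_def by (rule ifs_maps_compose[OF u GS])
    show "\<kappa> * \<epsilon> \<le> s" "s \<le> \<epsilon>" using t c by (simp_all add: s_def field_simps)
    have sub2: "inv G x \<in> inv g' ` F" if "x \<in> F" for x
    proof (rule image_eqI)
      show "inv G x = inv g' (u x)"
        using \<open>bij u\<close> by (simp add: inv_g' bij_is_inj)
      show "u x \<in> F" using ifs_maps_image_subset[OF F u] that by blast
    qed
    show "inv g ` F \<subseteq> inv g' ` F"
      by (rule order_trans[OF sub1 image_subsetI[OF sub2]])
    fix z assume "z \<in> inv g ` F"
    then have "z \<in> inv G ` F" by (rule subsetD[OF sub1])
    then obtain x where x: "x \<in> F" "z = inv G x" by blast
    have "norm ((Q ^^ n) \<omega> - \<omega>) \<le> \<eta>" using n(2)[of \<omega>] \<open>norm \<omega> = 1\<close> by simp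
    then have "norm (inv G (inv u (h x)) - inv G x - (t / c ^ n) *\<^sub>R \<omega>) \<le> (\<eta> + \<eta>) * (t / c ^ n)"
      by (rule similitude_inv_shift[OF G _ \<open>0 \<le> t\<close> uh[OF x(1)]])
    moreover have "h x \<in> F" using ifs_maps_image_subset[OF F h] x(1) by blast
    ultimately show "\<exists>x\<in>F. norm (inv g' x - z - s *\<^sub>R \<omega>) \<le> (\<eta> + \<eta>) * s"
      unfolding inv_g' s_def x(2) by blast
  qed
qed

text \<open>Repeat \<open>approximable_extend_step\<close> until the distance L is covered. Each a
  in reach is hit up to \<epsilon>, the coarseness of the steps, plus
  \<open>(\<eta> + \<eta>) * a\<close>, the accumulated error of direction. As the latter does not
  count steps, \<epsilon> and \<eta> can be fixed before \<kappa>, and with it the number of steps,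
  is known.\<close>

lemma approximable_translates:
  fixes S :: "(real^'n \<Rightarrow> real^'n) list"
  assumes ifs: "ifs S" and F: "attractor_of F S" and drift: "drift S F \<omega>" and "norm \<omega> = 1"
    and E: "approximable S F E" and "0 \<le> L"
  shows "approximable S F {z + a *\<^sub>R \<omega> |z a. z \<in> E \<and> 0 \<le> a \<and> a \<le> L}"
  unfolding approximable_def
proof (intro allI impI)
  fix \<delta> :: real assume "0 < \<delta>"
  \<comment> \<open>M is L made positive for the division. Coarseness and error of direction will
    cost \<open>\<delta> / 4\<close> each; the remaining \<open>\<delta> / 2\<close> goes into
    approximating E by \<open>g0\<inverse>(F)\<close>.\<close>
  define M where "M = L + 1"
  have M: "0 < M" "L \<le> M" using \<open>0 \<le> L\<close> by (simp_all add: M_def)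
  define \<epsilon> \<eta> where "\<epsilon> = \<delta> / 4" and "\<eta> = \<delta> / (8 * M)"
  have \<epsilon>: "0 < \<epsilon>" and \<eta>: "0 < \<eta>" using \<open>0 < \<delta>\<close> M by (auto simp: \<epsilon>_def \<eta>_def)
  obtain \<kappa> where \<kappa>: "0 < \<kappa>"
    "\<And>\<epsilon>. 0 < \<epsilon> \<Longrightarrow> \<exists>u\<in>ifs_maps S. \<exists>h\<in>ifs_maps S. \<exists>t. \<kappa> * \<epsilon> \<le> t \<and> t \<le> \<epsilon> \<and>
        (\<forall>x\<in>F. norm (inv u (h x) - x - t *\<^sub>R \<omega>) \<le> \<eta> * t)"
    using drift \<eta> unfolding drift_def by blast
  obtain g0 where g0: "g0 \<in> ifs_maps S" "\<And>z. z \<in> E \<Longrightarrow> \<exists>x\<in>F. norm (inv g0 x - z) \<le> \<delta> / 2"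
    using E \<open>0 < \<delta>\<close> unfolding approximable_def by (meson half_gt_zero)
  \<comment> \<open>All translates start from this fixed set, which the growing copies keep
    containing.\<close>
  define Y where "Y = inv g0 ` F"
  have "\<exists>g\<in>ifs_maps S. Y \<subseteq> inv g ` F \<and> (\<forall>a y. 0 \<le> a \<and> a \<le> real n * (\<kappa> * \<epsilon>) \<and> y \<in> Y \<longrightarrow>
          (\<exists>x\<in>F. norm (inv g x - y - a *\<^sub>R \<omega>) \<le> \<epsilon> + (\<eta> + \<eta>) * a))" for n
  proof (induction n)
    case 0
    have "\<exists>x\<in>F. norm (inv g0 x - y - a *\<^sub>R \<omega>) \<le> \<epsilon> + (\<eta> + \<eta>) * a"
      if "0 \<le> a" "a \<le> real 0 * (\<kappa> * \<epsilon>)" "y \<in> Y" for a y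
    proof -
      have "a = 0" using that by simp
      moreover obtain x where "x \<in> F" "y = inv g0 x" using \<open>y \<in> Y\<close> by (auto simp: Y_def)
      ultimately show ?thesis using \<epsilon> by (intro bexI[of _ x]) auto
    qed
    then show ?case using g0(1) by (intro bexI[of _ g0]) (auto simp: Y_def)
  next
    case (Suc n)
    then obtain g where g: "g \<in> ifs_maps S" "Y \<subseteq> inv g ` F"
      and near: "\<And>a y. 0 \<le> a \<Longrightarrow> a \<le> real n * (\<kappa> * \<epsilon>) \<Longrightarrow> y \<in> Y \<Longrightarrow>
          \<exists>x\<in>F. norm (inv g x - y - a *\<^sub>R \<omega>) \<le> \<epsilon> + (\<eta> + \<eta>) * a" by blast
    obtain g' s where g': "g' \<in> ifs_maps S" "\<kappa> * \<epsilon> \<le> s" "s \<le> \<epsilon>" "inv g ` F \<subseteq> inv g' ` F"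
      and shift: "\<And>z. z \<in> inv g ` F \<Longrightarrow> \<exists>x\<in>F. norm (inv g' x - z - s *\<^sub>R \<omega>) \<le> (\<eta> + \<eta>) * s"
      using approximable_extend_step[OF ifs F g(1) \<open>norm \<omega> = 1\<close> \<eta> \<kappa>(2) \<epsilon> \<kappa>(1)] by blast
    have "\<exists>x\<in>F. norm (inv g' x - y - a *\<^sub>R \<omega>) \<le> \<epsilon> + (\<eta> + \<eta>) * a"
      if a: "0 \<le> a" "a \<le> real (Suc n) * (\<kappa> * \<epsilon>)" and y: "y \<in> Y" for a y
    \<comment> \<open>For a < s the point y itself is close enough, as s is at most \<epsilon>.
      Otherwise the earlier copy reaches the translate by a - s, and the new step of length s is
      added last.\<close>
    proof (cases "a < s")
      case True
      obtain x where x: "x \<in> F" "y = inv g' x" using y g(2) g'(4) by blast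
      have "norm (inv g' x - y - a *\<^sub>R \<omega>) = a"
        using a \<open>norm \<omega> = 1\<close> by (simp add: x)
      also have "\<dots> \<le> \<epsilon> + (\<eta> + \<eta>) * a"
        using True g' a \<eta> by (intro add_increasing2) auto
      finally show ?thesis using x(1) by blast
    next
      case False
      have "a - s \<le> real n * (\<kappa> * \<epsilon>)"
        using a(2) g'(2) unfolding of_nat_Suc distrib_right by linarith
      then obtain x where x: "x \<in> F" "norm (inv g x - y - (a - s) *\<^sub>R \<omega>) \<le> \<epsilon> + (\<eta> + \<eta>) * (a - s)"
        using near[of "a - s" y] False y by auto
      obtain x' where x': "x' \<in> F" "norm (inv g' x' - inv g x - s *\<^sub>R \<omega>) \<le> (\<eta> + \<eta>) * s"
        using shift[of "inv g x"] x(1) by blast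
      have "inv g' x' - y - a *\<^sub>R \<omega> = (inv g' x' - inv g x - s *\<^sub>R \<omega>) + (inv g x - y - (a - s) *\<^sub>R \<omega>)"
        by (simp add: algebra_simps)
      then have "norm (inv g' x' - y - a *\<^sub>R \<omega>) \<le> (\<eta> + \<eta>) * s + (\<epsilon> + (\<eta> + \<eta>) * (a - s))"
        using norm_triangle_mono[OF x'(2) x(2)] by metis
      also have "\<dots> = \<epsilon> + (\<eta> + \<eta>) * a" by (simp add: algebra_simps)
      finally show ?thesis using x'(1) by blast
    qed
    then show ?case using g g' by (intro bexI[of _ g']) auto
  qed
  moreover obtain n where "L < real n * (\<kappa> * \<epsilon>)"
    using reals_Archimedean3[OF mult_pos_pos[OF \<kappa>(1) \<epsilon>]] by blast
  ultimately obtain g where g: "g \<in> ifs_maps S"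
    "\<And>a y. 0 \<le> a \<Longrightarrow> a \<le> L \<Longrightarrow> y \<in> Y \<Longrightarrow> \<exists>x\<in>F. norm (inv g x - y - a *\<^sub>R \<omega>) \<le> \<epsilon> + (\<eta> + \<eta>) * a"
    by (meson less_imp_le order_trans)
  have "\<exists>x\<in>F. norm (inv g x - (z + a *\<^sub>R \<omega>)) \<le> \<delta>" if z: "z \<in> E" and a: "0 \<le> a" "a \<le> L" for z a
  proof -
    obtain x0 where x0: "x0 \<in> F" "norm (inv g0 x0 - z) \<le> \<delta> / 2" using g0(2)[OF z] by blast
    obtain x where x: "x \<in> F" "norm (inv g x - inv g0 x0 - a *\<^sub>R \<omega>) \<le> \<epsilon> + (\<eta> + \<eta>) * a"
      using g(2)[OF a, of "inv g0 x0"] x0(1) unfolding Y_def by blast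
    have "(\<eta> + \<eta>) * a \<le> \<delta> / 4"
    proof -
      have "(\<eta> + \<eta>) * a \<le> (\<eta> + \<eta>) * M" using a \<eta> M by (intro mult_left_mono) auto
      also have "\<dots> = \<delta> / 4" using M by (simp add: \<eta>_def distrib_right)
      finally show ?thesis .
    qed
    then have "\<epsilon> + (\<eta> + \<eta>) * a \<le> \<delta> / 2" by (simp add: \<epsilon>_def)
    then have "norm ((inv g x - inv g0 x0 - a *\<^sub>R \<omega>) + (inv g0 x0 - z)) \<le> \<delta> / 2 + \<delta> / 2"
      by (intro norm_triangle_mono order_trans[OF x(2)] x0(2))
    moreover have "(inv g x - inv g0 x0 - a *\<^sub>R \<omega>) + (inv g0 x0 - z) = inv g x - (z + a *\<^sub>R \<omega>)"
      by (simp add: algebra_simps)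
    ultimately have "norm (inv g x - (z + a *\<^sub>R \<omega>)) \<le> \<delta>" by (metis field_sum_of_halves)
    then show ?thesis using x(1) by blast
  qed
  note near = this
  show "\<exists>g\<in>ifs_maps S. \<forall>z\<in>{z + a *\<^sub>R \<omega> |z a. z \<in> E \<and> 0 \<le> a \<and> a \<le> L}.
      \<exists>x\<in>F. norm (inv g x - z) \<le> \<delta>"
  proof (rule bexI[OF _ g(1)], rule ballI)
    fix w assume "w \<in> {z + a *\<^sub>R \<omega> |z a. z \<in> E \<and> 0 \<le> a \<and> a \<le> L}"
    then obtain z a where "w = z + a *\<^sub>R \<omega>" "z \<in> E" "0 \<le> a" "a \<le> L" by blast
    then show "\<exists>x\<in>F. norm (inv g x - w) \<le> \<delta>" using near by metis
  qed
qed

text \<open>The directions need not be orthogonal: they are added one at a time, each translating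
  the set obtained so far. Coefficients are nonnegative because a drift along b provides no motion
  along -b.\<close>

lemma approximable_sums:
  fixes S :: "(real^'n \<Rightarrow> real^'n) list"
  assumes ifs: "ifs S" and F: "attractor_of F S" and "finite B"
    and B: "\<And>b. b \<in> B \<Longrightarrow> drift S F b \<and> norm b = 1" and "0 \<le> L"
  shows "approximable S F {y + (\<Sum>b\<in>B. a b *\<^sub>R b) |y a. y \<in> F \<and> (\<forall>b\<in>B. 0 \<le> a b \<and> a b \<le> L)}"
  using \<open>finite B\<close> B
proof (induction B rule: finite_induct)
  case empty
  show ?case by (rule approximable_mono[OF approximable_self]) auto
next
  case (insert b B)
  let ?E = "{y + (\<Sum>b\<in>B. a b *\<^sub>R b) |y a. y \<in> F \<and> (\<forall>b\<in>B. 0 \<le> a b \<and> a b \<le> L)}"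
  have "approximable S F {z + a *\<^sub>R b |z a. z \<in> ?E \<and> 0 \<le> a \<and> a \<le> L}"
    using insert.IH insert.prems \<open>0 \<le> L\<close> by (intro approximable_translates[OF ifs F]) auto
  then show ?case
  proof (rule approximable_mono, intro subsetI)
    fix x assume "x \<in> {y + (\<Sum>b\<in>insert b B. a b *\<^sub>R b) |y a. y \<in> F \<and> (\<forall>b\<in>insert b B. 0 \<le> a b \<and> a b \<le> L)}"
    then obtain y a where ya: "x = y + (\<Sum>b\<in>insert b B. a b *\<^sub>R b)" "y \<in> F"
      "\<And>b'. b' \<in> insert b B \<Longrightarrow> 0 \<le> a b' \<and> a b' \<le> L" by blast
    then have "x = (y + (\<Sum>b\<in>B. a b *\<^sub>R b)) + a b *\<^sub>R b"
      using insert.hyps by (simp add: algebra_simps)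
    moreover have "y + (\<Sum>b\<in>B. a b *\<^sub>R b) \<in> ?E" using ya by blast
    ultimately show "x \<in> {z + a *\<^sub>R b |z a. z \<in> ?E \<and> 0 \<le> a \<and> a \<le> L}"
      using ya(3)[of b] by blast
  qed
qed

section \<open>Orthogonal projections\<close>

lemma orth_proj_unique:
  assumes "subspace V" "y \<in> V" "\<And>v. v \<in> V \<Longrightarrow> orthogonal (x - y) v"
  shows "orth_proj V x = y"
  unfolding orth_proj_def
proof (rule the_equality)
  fix z assume z: "z \<in> V \<and> (\<forall>v\<in>V. orthogonal (x - z) v)"
  have "z - y \<in> V" using assms z by (simp add: subspace_diff)
  then have "orthogonal ((x - y) - (x - z)) (z - y)"
    using assms(3) z orthogonal_clauses(4) orthogonal_commute
    by (metis (no_types, lifting) inner_diff_left orthogonal_def diff_self)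
  then show "z = y" by (simp add: orthogonal_self)
qed (use assms in auto)

lemma
  assumes "subspace V"
  shows orth_proj_mem: "orth_proj V x \<in> V"
    and orth_proj_orthogonal: "v \<in> V \<Longrightarrow> orthogonal (x - orth_proj V x) v"
proof -
  obtain y z where yz: "y \<in> span V" "\<And>w. w \<in> span V \<Longrightarrow> orthogonal z w" "x = y + z"
    using orthogonal_subspace_decomp_exists[of V x] by metis
  have sp: "span V = V" using assms by (simp add: span_eq_iff)
  have "orth_proj V x = y" using yz assms unfolding sp by (intro orth_proj_unique) auto
  then show "orth_proj V x \<in> V" "v \<in> V \<Longrightarrow> orthogonal (x - orth_proj V x) v"
    using yz unfolding sp by auto
qed

lemma orth_proj_add_orthogonal_comp:
  assumes "subspace V"
  shows "orth_proj V x + orth_proj (orthogonal_comp V) x = x"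
proof -
  have "orth_proj (orthogonal_comp V) x = x - orth_proj V x"
  proof (rule orth_proj_unique)
    show "x - orth_proj V x \<in> orthogonal_comp V"
      using orth_proj_orthogonal[OF assms] by (simp add: orthogonal_comp_def orthogonal_commute)
    fix v assume "v \<in> orthogonal_comp V"
    then show "orthogonal (x - (x - orth_proj V x)) v"
      using orth_proj_mem[OF assms] by (simp add: orthogonal_comp_def)
  qed (rule subspace_orthogonal_comp)
  then show ?thesis by simp
qed

lemma linear_orth_proj:
  assumes "subspace V"
  shows "linear (orth_proj V)"
proof (rule linearI)
  fix x y show "orth_proj V (x + y) = orth_proj V x + orth_proj V y"
  proof (rule orth_proj_unique[OF assms])
    fix v assume "v \<in> V"
    then have "(x - orth_proj V x) \<bullet> v = 0" "(y - orth_proj V y) \<bullet> v = 0"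
      using orth_proj_orthogonal[OF assms] by (auto simp: orthogonal_def)
    then show "orthogonal (x + y - (orth_proj V x + orth_proj V y)) v"
      by (simp add: orthogonal_def inner_diff_left inner_add_left)
  qed (simp add: assms orth_proj_mem subspace_add)
next
  fix c x show "orth_proj V (c *\<^sub>R x) = c *\<^sub>R orth_proj V x"
  proof (rule orth_proj_unique[OF assms])
    fix v assume "v \<in> V"
    then have "(x - orth_proj V x) \<bullet> v = 0"
      using orth_proj_orthogonal[OF assms] by (auto simp: orthogonal_def)
    then show "orthogonal (c *\<^sub>R x - c *\<^sub>R orth_proj V x) v"
      by (simp add: orthogonal_def inner_diff_left)
  qed (simp add: assms orth_proj_mem subspace_scale)
qed

lemma norm_orth_proj_le:
  assumes "subspace V"
  shows "norm (orth_proj V x) \<le> norm x"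
proof -
  have "orthogonal (orth_proj V x) (x - orth_proj V x)"
    using orth_proj_orthogonal[OF assms orth_proj_mem[OF assms]] by (simp add: orthogonal_commute)
  then have "(norm x)\<^sup>2 = (norm (orth_proj V x))\<^sup>2 + (norm (x - orth_proj V x))\<^sup>2"
    using norm_add_Pythagorean by fastforce
  then have "(norm (orth_proj V x))\<^sup>2 \<le> (norm x)\<^sup>2" by simp
  then show ?thesis by (rule power2_le_imp_le) simp
qed

lemma dist_orth_proj_le:
  assumes "subspace V"
  shows "dist (orth_proj V x) (orth_proj V y) \<le> dist x y"
  using norm_orth_proj_le[OF assms, of "x - y"] linear_diff[OF linear_orth_proj[OF assms]]
  by (simp add: dist_norm)

section \<open>Covering numbers and separated sets\<close>

lemma covering_number_le:
  assumes "finite C" "E \<subseteq> (\<Union>x\<in>C. cball x r)"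
  shows "covering_number r E \<le> card C"
  unfolding covering_number_def using assms by (intro Least_le) blast

lemma covering_number_cover:
  fixes E :: "(real^'n) set"
  assumes "bounded E" "0 < r"
  obtains C where "finite C" "card C = covering_number r E" "E \<subseteq> (\<Union>x\<in>C. cball x r)"
proof -
  have comp: "compact (closure E)" using assms by simp
  have sub: "closure E \<subseteq> (\<Union>x\<in>closure E. ball x r)" using assms by auto
  obtain C where "C \<subseteq> closure E" "finite C" "closure E \<subseteq> (\<Union>x\<in>C. ball x r)"
    using compactE_image[OF comp _ sub] open_ball by metis
  moreover have "(\<Union>x\<in>C. ball x r) \<subseteq> (\<Union>x\<in>C. cball x r)" by (intro UN_mono ball_subset_cball) simp
  ultimately have "E \<subseteq> (\<Union>x\<in>C. cball x r)"
    using closure_subset[of E] by (meson order_trans)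
  then have "\<exists>N C. finite C \<and> card C = N \<and> E \<subseteq> (\<Union>x\<in>C. cball x r)"
    using \<open>finite C\<close> by blast
  from LeastI_ex[OF this] show thesis
    using that unfolding covering_number_def[symmetric] by blast
qed

text \<open>A closed ball of radius r holds at most one point of D; the strict inequality excludes
  antipodal pairs.\<close>

lemma card_separated_le_covering_number:
  fixes E :: "(real^'n) set"
  assumes "bounded E" "0 < r" "D \<subseteq> E" "pairwise (\<lambda>x y. 2 * r < dist x y) D"
  shows "card D \<le> covering_number r E"
proof -
  obtain C where C: "finite C" "card C = covering_number r E" "E \<subseteq> (\<Union>x\<in>C. cball x r)"
    using covering_number_cover assms(1,2) by blast
  have "\<exists>c\<in>C. dist c x \<le> r" if "x \<in> D" for x
  proof -
    have "x \<in> (\<Union>c\<in>C. cball c r)" using that assms(3) C(3) by blast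
    then show ?thesis by simp
  qed
  then obtain f where f: "\<And>x. x \<in> D \<Longrightarrow> f x \<in> C \<and> dist (f x) x \<le> r" by metis
  have "inj_on f D"
  proof (rule inj_onI, rule ccontr)
    fix x y assume xy: "x \<in> D" "y \<in> D" "f x = f y" "x \<noteq> y"
    then have "2 * r < dist x y" using assms(4) by (auto simp: pairwise_def)
    also have "dist x y \<le> dist (f x) x + dist (f x) y" by (rule dist_triangle3)
    also have "\<dots> \<le> 2 * r" using f[OF xy(1)] f[OF xy(2)] xy(3) by simp
    finally show False by simp
  qed
  then show ?thesis using C f card_inj_on_le[of f D C] by auto
qed

text \<open>A separated set of maximal cardinality is a net, since an uncovered point could be
  added. The maximum exists because the covering number at radius \<open>r / 2\<close> bounds all
  such cardinalities.\<close>

lemma covering_number_le_card_separated: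
  fixes E :: "(real^'n) set"
  assumes "bounded E" "0 < r"
  obtains D where "finite D" "D \<subseteq> E" "pairwise (\<lambda>x y. r \<le> dist x y) D" "covering_number r E \<le> card D"
proof -
  define P where "P n \<longleftrightarrow> (\<exists>D. finite D \<and> D \<subseteq> E \<and> pairwise (\<lambda>x y. r < dist x y) D \<and> card D = n)" for n
  have "P 0" unfolding P_def by (intro exI[of _ "{}"]) auto
  have bound: "\<forall>n. P n \<longrightarrow> n \<le> covering_number (r / 2) E"
    using card_separated_le_covering_number[OF assms(1), of "r / 2"] assms(2) by (auto simp: P_def)
  obtain n where n: "P n" "\<And>m. P m \<Longrightarrow> m \<le> n"
    using GreatestI_nat[of P 0] Greatest_le_nat[of P] \<open>P 0\<close> bound by blast
  then obtain D where D: "finite D" "D \<subseteq> E" "pairwise (\<lambda>x y. r < dist x y) D" "card D = n"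
    by (auto simp: P_def)
  have "E \<subseteq> (\<Union>x\<in>D. cball x r)"
  proof (rule ccontr)
    assume "\<not> E \<subseteq> (\<Union>x\<in>D. cball x r)"
    then obtain y where y: "y \<in> E" "y \<notin> (\<Union>x\<in>D. cball x r)" by blast
    then have y: "y \<in> E" "\<And>x. x \<in> D \<Longrightarrow> r < dist x y" by (simp_all add: not_le)
    then have "y \<notin> D" using assms(2) by force
    have "pairwise (\<lambda>x y. r < dist x y) (insert y D)"
      using D(3) y(2) by (auto simp: pairwise_insert dist_commute)
    then have "P (Suc n)"
      unfolding P_def using D y \<open>y \<notin> D\<close> by (intro exI[of _ "insert y D"]) auto
    then show False using n(2) by fastforce
  qed
  then have "covering_number r E \<le> card D" using D covering_number_le by blast
  moreover have "pairwise (\<lambda>x y. r \<le> dist x y) D"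
    using D(3) by (rule pairwise_mono) auto
  ultimately show thesis using that D by blast
qed

text \<open>The admissible exponents of the dimension, named so that both inequalities can be proved
  for a single exponent and the infimum is taken only at the end.\<close>

definition assouad_bound :: "(real^'n) set \<Rightarrow> real \<Rightarrow> bool" where
  "assouad_bound E s \<longleftrightarrow> 0 \<le> s \<and> (\<exists>c. \<forall>r R. 0 < r \<and> r < R \<longrightarrow>
     (\<forall>x\<in>E. real (covering_number r (cball x R \<inter> E)) \<le> c * (R / r) powr s))"

lemma assouad_dim_eq: "assouad_dim E = Inf {s. assouad_bound E s}"
  by (simp add: assouad_dim_def assouad_bound_def)

lemma bdd_below_assouad_bound: "bdd_below {s. assouad_bound E s}"
  by (rule bdd_belowI[of _ 0]) (simp add: assouad_bound_def)

text \<open>Separated sets survive perturbation and rescaling more easily than covers. Points at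
  mutual distance r need distinct balls of radius \<open>r / 3\<close>, which only changes the
  constant by \<open>3 powr s\<close>.\<close>

lemma assouad_bound_iff_separated:
  "assouad_bound E s \<longleftrightarrow> 0 \<le> s \<and> (\<exists>c. \<forall>r R x D. 0 < r \<and> r < R \<and> x \<in> E \<and> finite D \<and>
     D \<subseteq> cball x R \<inter> E \<and> pairwise (\<lambda>x y. r \<le> dist x y) D \<longrightarrow> real (card D) \<le> c * (R / r) powr s)"
  (is "?L \<longleftrightarrow> ?R")
proof
  assume ?L
  then obtain c where "0 \<le> s" and c: "\<And>r R x. 0 < r \<Longrightarrow> r < R \<Longrightarrow> x \<in> E \<Longrightarrow>
      real (covering_number r (cball x R \<inter> E)) \<le> c * (R / r) powr s"
    by (auto simp: assouad_bound_def)
  have "real (card D) \<le> (c * 3 powr s) * (R / r) powr s"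
    if "0 < r" "r < R" "x \<in> E" "D \<subseteq> cball x R \<inter> E" "pairwise (\<lambda>x y. r \<le> dist x y) D"
    for r R x D
  proof -
    have "pairwise (\<lambda>x y. 2 * (r / 3) < dist x y) D"
      using that(5) by (rule pairwise_mono) (use that in auto)
    then have "card D \<le> covering_number (r / 3) (cball x R \<inter> E)"
      using that by (intro card_separated_le_covering_number) (auto simp: bounded_Int)
    then have "real (card D) \<le> real (covering_number (r / 3) (cball x R \<inter> E))" by simp
    also have "\<dots> \<le> c * (R / (r / 3)) powr s"
      using that by (intro c) auto
    also have "R / (r / 3) = 3 * (R / r)" by simp
    also have "(3 * (R / r)) powr s = 3 powr s * (R / r) powr s"
      by (rule powr_mult)
    finally show ?thesis by (simp add: mult.assoc)
  qed
  then show ?R using \<open>0 \<le> s\<close> by blast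
next
  assume ?R
  then obtain c where "0 \<le> s" and c: "\<And>r R x D. 0 < r \<Longrightarrow> r < R \<Longrightarrow> x \<in> E \<Longrightarrow> finite D \<Longrightarrow>
      D \<subseteq> cball x R \<inter> E \<Longrightarrow> pairwise (\<lambda>x y. r \<le> dist x y) D \<Longrightarrow> real (card D) \<le> c * (R / r) powr s"
    by blast
  have "real (covering_number r (cball x R \<inter> E)) \<le> c * (R / r) powr s"
    if "0 < r" "r < R" "x \<in> E" for r R x
  proof -
    have "bounded (cball x R \<inter> E)" by (simp add: bounded_Int)
    then obtain D where "finite D" "D \<subseteq> cball x R \<inter> E" "pairwise (\<lambda>x y. r \<le> dist x y) D"
      "covering_number r (cball x R \<inter> E) \<le> card D"
      using covering_number_le_card_separated \<open>0 < r\<close> by blast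
    then show ?thesis using c[OF that] by (meson of_nat_mono order_trans)
  qed
  then show ?L using \<open>0 \<le> s\<close> by (auto simp: assouad_bound_def)
qed

lemma orthonormal_inner_sum:
  fixes B :: "'a::euclidean_space set"
  assumes "finite B" "pairwise orthogonal B" "\<And>b. b \<in> B \<Longrightarrow> norm b = 1" "b \<in> B"
  shows "(\<Sum>b\<in>B. f b *\<^sub>R b) \<bullet> b = f b"
proof -
  have "(\<Sum>b\<in>B. f b *\<^sub>R b) \<bullet> b = (\<Sum>b'\<in>B. if b' = b then f b else 0)"
    unfolding inner_sum_left
  proof (rule sum.cong)
    fix b' assume "b' \<in> B"
    then show "(f b' *\<^sub>R b') \<bullet> b = (if b' = b then f b else 0)"
      using assms by (auto simp: pairwise_def orthogonal_def dot_square_norm)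
  qed simp
  then show ?thesis using assms by simp
qed

lemma orthonormal_expansion:
  fixes B :: "'a::euclidean_space set"
  assumes "finite B" "pairwise orthogonal B" "\<And>b. b \<in> B \<Longrightarrow> norm b = 1" "w \<in> span B"
  shows "(\<Sum>b\<in>B. (w \<bullet> b) *\<^sub>R b) = w"
proof -
  obtain f where f: "w = (\<Sum>b\<in>B. f b *\<^sub>R b)"
    using assms(1,4) by (auto simp: span_finite)
  then have "w \<bullet> b = f b" if "b \<in> B" for b
    using orthonormal_inner_sum[OF assms(1-3) that] by simp
  then show ?thesis using f by simp
qed

lemma subspace_cover:
  fixes V :: "'a::euclidean_space set"
  assumes "subspace V"
  obtains K where "\<And>r R. 0 < r \<Longrightarrow> r < R \<Longrightarrow>
    \<exists>C. finite C \<and> real (card C) \<le> K * (R / r) ^ dim V \<and> cball 0 R \<inter> V \<subseteq> (\<Union>q\<in>C. cball q r)"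
proof -
  obtain B where B: "B \<subseteq> V" "pairwise orthogonal B" "\<And>x. x \<in> B \<Longrightarrow> norm x = 1"
    "independent B" "card B = dim V" "span B = V"
    using orthonormal_basis_subspace[OF assms] by blast
  have "finite B" using B(4) by (rule independent_imp_finite)
  define l where "l = dim V"
  have "\<exists>C. finite C \<and> real (card C) \<le> (5 * (real l + 1)) ^ l * (R / r) ^ l \<and>
      cball 0 R \<inter> V \<subseteq> (\<Union>q\<in>C. cball q r)" if r: "0 < r" "r < R" for r R :: real
  proof -
    \<comment> \<open>Mesh of a grid in orthonormal coordinates: rounding l coordinates moves a
      point by at most \<open>real l * q\<close>, hence by at most r. The added 1 covers l =
      0.\<close>
    define q where "q = r / (real l + 1)"
    have q: "0 < q" "q \<le> r" "real l * q \<le> r" using r by (auto simp: q_def field_simps)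
    define m where "m = \<lceil>R / q\<rceil>"
    have m: "R / q \<le> of_int m" "of_int m \<le> R / q + 1"
      unfolding m_def by linarith+
    have "0 < R / q" using q r by simp
    then have "0 \<le> m" using m(1) by linarith
    note m = m this
    define J where "J = PiE B (\<lambda>_. {-m..m})"
    define C where "C = (\<lambda>j. \<Sum>b\<in>B. (q * of_int (j b)) *\<^sub>R b) ` J"
    have J: "finite J" "card J = nat (2 * m + 1) ^ l"
      using \<open>finite B\<close> B(5) by (auto simp: J_def l_def card_PiE intro!: finite_PiE)
    have "real (card C) \<le> real (card J)" unfolding C_def using card_image_le[OF J(1)] by simp
    also have "\<dots> = (2 * of_int m + 1) ^ l" using J m by simp
    \<comment> \<open>With \<open>1 \<le> R / q\<close>, the estimate
      \<open>2 * (R / q + 1) + 1\<close> for the number of grid values is absorbed into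
      \<open>5 * (R / q)\<close>.\<close>
    also have "\<dots> \<le> (5 * (R / q)) ^ l"
    proof (rule power_mono)
      have "1 \<le> R / q" using q r by simp
      then show "2 * of_int m + 1 \<le> 5 * (R / q)" using m by linarith
    qed (use m in auto)
    also have "5 * (R / q) = (5 * (real l + 1)) * (R / r)"
      using r by (simp add: q_def field_simps)
    finally have card: "real (card C) \<le> (5 * (real l + 1)) ^ l * (R / r) ^ l"
      by (simp only: power_mult_distrib)
    have "cball 0 R \<inter> V \<subseteq> (\<Union>x\<in>C. cball x r)"
    proof
      fix w assume w: "w \<in> cball 0 R \<inter> V"
      define j where "j = restrict (\<lambda>b. \<lfloor>(w \<bullet> b) / q\<rfloor>) B"
      have "j \<in> J"
        unfolding J_def
      proof (rule PiE_I)
        fix b assume b: "b \<in> B"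
        have "\<bar>w \<bullet> b\<bar> \<le> norm w * norm b" by (rule Cauchy_Schwarz_ineq2)
        also have "\<dots> \<le> R" using w B(3)[OF b] by simp
        finally have "\<bar>(w \<bullet> b) / q\<bar> \<le> R / q" using q by (simp add: divide_right_mono)
        then have "of_int (- m) \<le> (w \<bullet> b) / q" "(w \<bullet> b) / q < of_int m + 1"
          using m(1) unfolding of_int_minus by linarith+
        then have "- m \<le> \<lfloor>(w \<bullet> b) / q\<rfloor>" "\<lfloor>(w \<bullet> b) / q\<rfloor> \<le> m"
          by (simp_all only: le_floor_iff floor_le_iff)
        then show "j b \<in> {-m..m}" using b by (simp add: j_def)
      qed (simp add: j_def)
      have "w - (\<Sum>b\<in>B. (q * of_int (j b)) *\<^sub>R b) = (\<Sum>b\<in>B. (w \<bullet> b - q * of_int (j b)) *\<^sub>R b)"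
        using orthonormal_expansion[OF \<open>finite B\<close> B(2,3), of w] w B(6)
        by (simp add: scaleR_diff_left sum_subtractf)
      moreover have "norm \<dots> \<le> real (card B) * q"
      proof (rule sum_norm_bound)
        fix b assume b: "b \<in> B"
        define t where "t = (w \<bullet> b) / q"
        have "\<bar>t - of_int \<lfloor>t\<rfloor>\<bar> \<le> 1" by linarith
        then have "q * \<bar>t - of_int \<lfloor>t\<rfloor>\<bar> \<le> q * 1" using q by (intro mult_left_mono) auto
        moreover have "w \<bullet> b - q * of_int (j b) = q * (t - of_int \<lfloor>t\<rfloor>)"
          using b q by (simp add: j_def t_def right_diff_distrib)
        ultimately have "\<bar>w \<bullet> b - q * of_int (j b)\<bar> \<le> q" using q by (simp add: abs_mult)
        then show "norm ((w \<bullet> b - q * of_int (j b)) *\<^sub>R b) \<le> q" using B(3)[OF b] by simp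
      qed
      ultimately have "norm (w - (\<Sum>b\<in>B. (q * of_int (j b)) *\<^sub>R b)) \<le> r"
        using q B(5) by (simp add: l_def)
      then show "w \<in> (\<Union>x\<in>C. cball x r)"
        using \<open>j \<in> J\<close> unfolding C_def by (auto simp: dist_norm norm_minus_commute)
    qed
    then show ?thesis using card J by (intro exI[of _ C]) (auto simp: C_def)
  qed
  then show thesis using that unfolding l_def by blast
qed

lemma subspace_separated:
  fixes V :: "'a::euclidean_space set"
  assumes "subspace V"
  obtains K where "0 < K" "\<And>r R. 0 < r \<Longrightarrow> r < R \<Longrightarrow> \<exists>D. finite D \<and> D \<subseteq> cball 0 R \<inter> V \<and>
    pairwise (\<lambda>x y. r \<le> dist x y) D \<and> K * (R / r) ^ dim V \<le> real (card D)"
proof -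
  obtain B where B: "B \<subseteq> V" "pairwise orthogonal B" "\<And>x. x \<in> B \<Longrightarrow> norm x = 1"
    "independent B" "card B = dim V" "span B = V"
    using orthonormal_basis_subspace[OF assms] by blast
  have "finite B" using B(4) by (rule independent_imp_finite)
  define l where "l = dim V"
  have "\<exists>D. finite D \<and> D \<subseteq> cball 0 R \<inter> V \<and> pairwise (\<lambda>x y. r \<le> dist x y) D \<and>
      (1 / (real l + 1)) ^ l * (R / r) ^ l \<le> real (card D)" if r: "0 < r" "r < R" for r R :: real
  proof -
    \<comment> \<open>Grid of mesh r with coordinates from 0 to m: distinct points differ by at
      least r in some coordinate, and \<open>l * r * m \<le> R\<close> keeps all of them in the
      ball. Having m + 1 values per coordinate makes up for rounding down.\<close>
    define m where "m = nat \<lfloor>R / (r * (real l + 1))\<rfloor>"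
    have "0 \<le> R / (r * (real l + 1))" using r by simp
    then have m: "real m \<le> R / (r * (real l + 1))" "R / (r * (real l + 1)) \<le> real m + 1"
      unfolding m_def by linarith+
    define J where "J = PiE B (\<lambda>_. {0..m})"
    define f where "f j = (\<Sum>b\<in>B. (r * real (j b)) *\<^sub>R b)" for j
    have J: "finite J" "card J = Suc m ^ l"
      using \<open>finite B\<close> B(5) by (auto simp: J_def l_def card_PiE intro!: finite_PiE)
    have sep: "r \<le> dist (f j) (f j')" if j: "j \<in> J" "j' \<in> J" "j \<noteq> j'" for j j'
    proof -
      obtain b where b: "b \<in> B" "j b \<noteq> j' b" using j PiE_ext unfolding J_def by metis
      then have "1 \<le> \<bar>real (j b) - real (j' b)\<bar>" by linarith
      then have "r * 1 \<le> r * \<bar>real (j b) - real (j' b)\<bar>" using r by (intro mult_left_mono) auto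
      also have "\<dots> = \<bar>(f j - f j') \<bullet> b\<bar>"
        using orthonormal_inner_sum[OF \<open>finite B\<close> B(2,3) b(1)] r
        by (simp add: f_def inner_diff_left abs_mult flip: right_diff_distrib)
      also have "\<dots> \<le> norm (f j - f j') * norm b" by (rule Cauchy_Schwarz_ineq2)
      finally show ?thesis using B(3)[OF b(1)] by (simp add: dist_norm)
    qed
    have inj: "inj_on f J"
      using sep r by (intro inj_onI) (metis dist_self not_le)
    have "f j \<in> cball 0 R \<inter> V" if "j \<in> J" for j
    proof -
      have "norm (f j) \<le> real (card B) * (r * real m)"
        unfolding f_def
      proof (rule sum_norm_bound)
        fix b assume b: "b \<in> B"
        then have "j b \<le> m" using that by (auto simp: J_def)
        then show "norm ((r * real (j b)) *\<^sub>R b) \<le> r * real m"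
          using B(3)[OF b] r by (simp add: abs_mult)
      qed
      also have "\<dots> \<le> (real l + 1) * (r * (R / (r * (real l + 1))))"
        using m r B(5) by (intro mult_mono) (auto simp: l_def)
      also have "\<dots> = R"
      proof -
        have "k * (r * (R / (r * k))) = R" if "k \<noteq> 0" for k using r that by simp
        then show ?thesis by simp
      qed
      finally have "norm (f j) \<le> R" .
      moreover have "f j \<in> V"
        unfolding f_def using B(1) by (intro subspace_sum[OF assms] subspace_scale[OF assms]) auto
      ultimately show ?thesis by simp
    qed
    moreover have "pairwise (\<lambda>x y. r \<le> dist x y) (f ` J)"
      using sep by (auto simp: pairwise_def)
    moreover have "(1 / (real l + 1)) ^ l * (R / r) ^ l \<le> real (card (f ` J))"
    proof -
      have "(1 / (real l + 1)) ^ l * (R / r) ^ l = (R / (r * (real l + 1))) ^ l"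
        unfolding power_mult_distrib[symmetric] by (simp add: mult.commute)
      also have "\<dots> \<le> (real m + 1) ^ l" using m r by (intro power_mono) auto
      finally show ?thesis using J by (simp add: card_image[OF inj] add.commute)
    qed
    ultimately show ?thesis using J by (intro exI[of _ "f ` J"]) auto
  qed
  then show thesis using that[of "(1 / (real l + 1)) ^ l"] unfolding l_def by auto
qed

section \<open>The upper bound\<close>

lemma assouad_bound_orth_proj_imp:
  fixes E :: "(real^'n) set"
  assumes V: "subspace V" and bound: "assouad_bound (orth_proj (orthogonal_comp V) ` E) s"
  shows "assouad_bound E (real (dim V) + s)"
proof -
  define P where "P = orth_proj V"
  define Q where "Q = orth_proj (orthogonal_comp V)"
  obtain K where K: "\<And>r R. 0 < r \<Longrightarrow> r < R \<Longrightarrow>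
    \<exists>C. finite C \<and> real (card C) \<le> K * (R / r) ^ dim V \<and> cball 0 R \<inter> V \<subseteq> (\<Union>q\<in>C. cball q r)"
    using subspace_cover[OF V] by blast
  obtain c where "0 \<le> s" and c: "\<And>r R x. 0 < r \<Longrightarrow> r < R \<Longrightarrow> x \<in> Q ` E \<Longrightarrow>
      real (covering_number r (cball x R \<inter> Q ` E)) \<le> c * (R / r) powr s"
    using bound unfolding assouad_bound_def Q_def by blast
  have "real (covering_number r (cball x R \<inter> E)) \<le>
      (c * K * 2 powr (real (dim V) + s)) * (R / r) powr (real (dim V) + s)"
    if r: "0 < r" "r < R" and x: "x \<in> E" for r R x
  proof -
    \<comment> \<open>Both factors are covered at radius \<open>r / 2\<close>, so the errors add up
      to r; this halving is the source of the power of 2. Using \<open>P (y - x)\<close> instead of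
      \<open>P y\<close> centres the factor in V at 0.\<close>
    have r': "0 < r / 2" "r / 2 < R" using r by auto
    have "bounded (cball (Q x) R \<inter> Q ` E)" by (simp add: bounded_Int)
    then obtain C1 where C1: "finite C1" "card C1 = covering_number (r / 2) (cball (Q x) R \<inter> Q ` E)"
      "cball (Q x) R \<inter> Q ` E \<subseteq> (\<Union>p\<in>C1. cball p (r / 2))"
      using covering_number_cover r'(1) by blast
    obtain C2 where C2: "finite C2" "real (card C2) \<le> K * (R / (r / 2)) ^ dim V"
      "cball 0 R \<inter> V \<subseteq> (\<Union>q\<in>C2. cball q (r / 2))"
      using K[OF r'] by blast
    define C where "C = (\<lambda>(p, q). p + q + P x) ` (C1 \<times> C2)"
    have "cball x R \<inter> E \<subseteq> (\<Union>z\<in>C. cball z r)"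
    proof
      fix y assume y: "y \<in> cball x R \<inter> E"
      have "dist (Q x) (Q y) \<le> R"
        using y dist_orth_proj_le[OF subspace_orthogonal_comp, of V x y] unfolding Q_def by simp
      then obtain p where p: "p \<in> C1" "dist p (Q y) \<le> r / 2" using C1(3) y by auto
      have "P (y - x) \<in> cball 0 R \<inter> V"
        using y norm_orth_proj_le[OF V, of "y - x"] orth_proj_mem[OF V]
        unfolding P_def by (simp add: dist_norm norm_minus_commute)
      then obtain q where q: "q \<in> C2" "dist q (P (y - x)) \<le> r / 2" using C2(3) by auto
      have "y = Q y + P (y - x) + P x"
        using orth_proj_add_orthogonal_comp[OF V, of y] linear_diff[OF linear_orth_proj[OF V]]
        unfolding P_def Q_def by (simp add: add.commute)
      then have "dist (p + q + P x) y = norm ((p - Q y) + (q - P (y - x)))"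
        unfolding dist_norm by (metis add_diff_add add_diff_cancel_right)
      also have "\<dots> \<le> r / 2 + r / 2"
        using p q by (intro norm_triangle_mono) (simp_all add: dist_norm)
      finally show "y \<in> (\<Union>z\<in>C. cball z r)"
        using p(1) q(1) unfolding C_def by force
    qed
    then have "covering_number r (cball x R \<inter> E) \<le> card C"
      using C1 C2 by (intro covering_number_le) (auto simp: C_def)
    also have "\<dots> \<le> card C1 * card C2"
      unfolding C_def using C1 C2 card_image_le[of "C1 \<times> C2"] by (simp add: card_cartesian_product)
    finally have "real (covering_number r (cball x R \<inter> E)) \<le> real (card C1) * real (card C2)"
      by (metis of_nat_le_iff of_nat_mult)
    also have "\<dots> \<le> (c * (R / (r / 2)) powr s) * (K * (R / (r / 2)) ^ dim V)"
      using c[OF r', of "Q x"] x C1(2) C2(2) by (intro mult_mono) (auto intro: order_trans[of _ "real (card C1)"])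
    also have "\<dots> = c * K * (R / (r / 2)) powr (real (dim V) + s)"
      using r by (simp add: powr_add powr_realpow)
    also have "R / (r / 2) = 2 * (R / r)" by simp
    also have "(2 * (R / r)) powr (real (dim V) + s) = 2 powr (real (dim V) + s) * (R / r) powr (real (dim V) + s)"
      by (rule powr_mult)
    finally show ?thesis by (simp add: mult.assoc)
  qed
  then show ?thesis using \<open>0 \<le> s\<close> unfolding assouad_bound_def by (intro conjI exI) auto
qed

text \<open>The case V = UNIV, where the complementary projection is a point. It shows that
  admissible exponents exist, so that the infimum over the reals is meaningful.\<close>

lemma assouad_bound_CARD: "assouad_bound (E :: (real^'n) set) (real CARD('n))"
proof -
  have Q: "orth_proj (orthogonal_comp UNIV) ` E \<subseteq> {0}"
    using orth_proj_mem[OF subspace_single_0] by auto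
  have "covering_number r (cball x R \<inter> orth_proj (orthogonal_comp UNIV) ` E) \<le> 1"
    if "0 < r" for r R and x :: "real^'n"
  proof -
    have "covering_number r (cball x R \<inter> orth_proj (orthogonal_comp UNIV) ` E) \<le> card {0 :: real^'n}"
      using Q that by (intro covering_number_le) auto
    then show ?thesis by simp
  qed
  then have "assouad_bound (orth_proj (orthogonal_comp UNIV) ` E) 0"
    unfolding assouad_bound_def by (intro conjI exI[of _ 1]) auto
  then show ?thesis using assouad_bound_orth_proj_imp[OF subspace_UNIV] by fastforce
qed

lemma assouad_dim_le_dim_add:
  fixes E :: "(real^'n) set"
  assumes "subspace V"
  shows "assouad_dim E \<le> real (dim V) + assouad_dim (orth_proj (orthogonal_comp V) ` E)"
proof -
  have "assouad_dim E - real (dim V) \<le> s" if "assouad_bound (orth_proj (orthogonal_comp V) ` E) s" for s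
    using cInf_lower[OF _ bdd_below_assouad_bound, of "real (dim V) + s" E]
      assouad_bound_orth_proj_imp[OF assms that] unfolding assouad_dim_eq by simp
  then have "assouad_dim E - real (dim V) \<le> assouad_dim (orth_proj (orthogonal_comp V) ` E)"
    unfolding assouad_dim_eq[of "_ ` E"] using assouad_bound_CARD
    by (intro cInf_greatest) auto
  then show ?thesis by simp
qed

section \<open>The lower bound\<close>

lemma norm_diff_add_le: "norm (a - b + c) \<le> norm a + norm b + norm c"
  for a b c :: "'a::real_normed_vector"
  using norm_triangle_ineq[of "a - b" c] norm_triangle_ineq4[of a b] by linarith

text \<open>Replaces overlapping directions by finitely many unit drift directions. Under weak
  separation the empty set serves, so later arguments need no case distinction.\<close>

lemma overlap_space_subset_span:
  fixes S :: "(real^'n \<Rightarrow> real^'n) list"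
  assumes ifs: "ifs S" and F: "attractor_of F S"
  obtains B where "finite B" "\<And>b. b \<in> B \<Longrightarrow> drift S F b \<and> norm b = 1" "overlap_space S F \<subseteq> span B"
proof (cases "weak_separation S")
  case True
  then show thesis using that[of "{}"] by (simp add: overlap_space_def)
next
  case False
  obtain B where B: "B \<subseteq> {\<omega>. overlapping_direction S F \<omega>}" "independent B"
    "{\<omega>. overlapping_direction S F \<omega>} \<subseteq> span B"
    using maximal_independent_subset by blast
  have "drift S F b \<and> norm b = 1" if "b \<in> B" for b
  proof -
    have "overlapping_direction S F b" using B(1) that by blast
    then show ?thesis
      using drift_if_overlapping_direction[OF ifs F] by (auto simp: overlapping_direction_def Let_def)
  qed
  moreover have "overlap_space S F \<subseteq> span B"
    using False B(3) by (simp add: overlap_space_def span_minimal)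
  ultimately show thesis using that independent_imp_finite[OF B(2)] by blast
qed

lemma subspace_overlap_space: "subspace (overlap_space S F)"
  by (simp add: overlap_space_def)

text \<open>With P and Q the projections to V and its complement,
  \<open>z + v + Q y = y + (z + (v - P y))\<close>, and \<open>v - P y\<close> is a vector of V of
  bounded norm. Its coefficients over the drift directions lie between -M and M but may be negative;
  the offset z adds M to each of them, which moves them into the interval from 0 to 2M that
  \<open>approximable_sums\<close> can handle.\<close>

lemma approximable_product:
  fixes S :: "(real^'n \<Rightarrow> real^'n) list"
  assumes ifs: "ifs S" and F: "attractor_of F S" and V: "subspace V" "V \<subseteq> overlap_space S F"
    and "0 \<le> R"
  obtains z where
    "approximable S F {z + v + orth_proj (orthogonal_comp V) y |v y. v \<in> V \<and> norm v \<le> R \<and> y \<in> F}"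
proof -
  obtain B where B: "finite B" "\<And>b. b \<in> B \<Longrightarrow> drift S F b \<and> norm b = 1" "overlap_space S F \<subseteq> span B"
    using overlap_space_subset_span[OF ifs F] by blast
  obtain C where C: "C \<subseteq> V" "pairwise orthogonal C" "\<And>x. x \<in> C \<Longrightarrow> norm x = 1"
    "independent C" "card C = dim V" "span C = V"
    using orthonormal_basis_subspace[OF V(1)] by blast
  have "finite C" using C(4) by (rule independent_imp_finite)
  have "\<forall>c\<in>C. \<exists>u. c = (\<Sum>b\<in>B. u b *\<^sub>R b)"
  proof
    fix c assume "c \<in> C"
    then have "c \<in> span B" using C(1) V(2) B(3) by blast
    then show "\<exists>u. c = (\<Sum>b\<in>B. u b *\<^sub>R b)" using B(1) by (auto simp: span_finite)
  qed
  then obtain u where u: "\<And>c. c \<in> C \<Longrightarrow> c = (\<Sum>b\<in>B. u c b *\<^sub>R b)" by metis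
  have "bounded F" using F by (simp add: attractor_of_def compact_imp_bounded)
  then obtain D where D: "\<And>x. x \<in> F \<Longrightarrow> norm x \<le> D" by (auto simp: bounded_iff)
  have "0 \<le> D"
    using F D norm_ge_zero unfolding attractor_of_def by (metis ex_in_conv order_trans)
  define M where "M = (R + D) * (\<Sum>c\<in>C. \<Sum>b\<in>B. \<bar>u c b\<bar>)"
  have M: "0 \<le> M" unfolding M_def using \<open>0 \<le> R\<close> \<open>0 \<le> D\<close> by (intro mult_nonneg_nonneg sum_nonneg) auto
  \<comment> \<open>Coefficients over B of vectors of V, chosen through the orthonormal basis C so
    that the norm of the vector bounds them explicitly.\<close>
  define coef where "coef w b = (\<Sum>c\<in>C. (w \<bullet> c) * u c b)" for w b
  have coef_sum: "w = (\<Sum>b\<in>B. coef w b *\<^sub>R b)" if "w \<in> V" for w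
  proof -
    have "w = (\<Sum>c\<in>C. (w \<bullet> c) *\<^sub>R c)"
      using orthonormal_expansion[OF \<open>finite C\<close> C(2,3), of w] that C(6) by simp
    also have "\<dots> = (\<Sum>c\<in>C. \<Sum>b\<in>B. ((w \<bullet> c) * u c b) *\<^sub>R b)"
    proof (rule sum.cong)
      fix c assume "c \<in> C"
      have "(w \<bullet> c) *\<^sub>R c = (w \<bullet> c) *\<^sub>R (\<Sum>b\<in>B. u c b *\<^sub>R b)"
        using u[OF \<open>c \<in> C\<close>] by (rule arg_cong)
      then show "(w \<bullet> c) *\<^sub>R c = (\<Sum>b\<in>B. ((w \<bullet> c) * u c b) *\<^sub>R b)"
        by (simp add: scaleR_sum_right)
    qed simp
    also have "\<dots> = (\<Sum>b\<in>B. coef w b *\<^sub>R b)"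
      unfolding coef_def scaleR_sum_left by (rule sum.swap)
    finally show ?thesis .
  qed
  have coef_bound: "\<bar>coef w b\<bar> \<le> M" if w: "norm w \<le> R + D" and b: "b \<in> B" for w b
  proof -
    have "\<bar>coef w b\<bar> \<le> (\<Sum>c\<in>C. \<bar>(w \<bullet> c) * u c b\<bar>)"
      unfolding coef_def by (rule sum_abs)
    also have "\<dots> \<le> (\<Sum>c\<in>C. (R + D) * (\<Sum>b\<in>B. \<bar>u c b\<bar>))"
    proof (rule sum_mono)
      fix c assume "c \<in> C"
      have "\<bar>w \<bullet> c\<bar> \<le> R + D"
        using Cauchy_Schwarz_ineq2[of w c] C(3)[OF \<open>c \<in> C\<close>] w by simp
      moreover have "\<bar>u c b\<bar> \<le> (\<Sum>b\<in>B. \<bar>u c b\<bar>)"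
        using B(1) b by (intro member_le_sum) auto
      ultimately show "\<bar>(w \<bullet> c) * u c b\<bar> \<le> (R + D) * (\<Sum>b\<in>B. \<bar>u c b\<bar>)"
        unfolding abs_mult by (intro mult_mono) (use \<open>0 \<le> R\<close> \<open>0 \<le> D\<close> in auto)
    qed
    finally show ?thesis by (simp add: M_def sum_distrib_left)
  qed
  define z where "z = (\<Sum>b\<in>B. M *\<^sub>R b)"
  have "approximable S F {y + (\<Sum>b\<in>B. a b *\<^sub>R b) |y a. y \<in> F \<and> (\<forall>b\<in>B. 0 \<le> a b \<and> a b \<le> 2 * M)}"
    using B(2) M by (intro approximable_sums[OF ifs F B(1)]) auto
  then have "approximable S F {z + v + orth_proj (orthogonal_comp V) y |v y. v \<in> V \<and> norm v \<le> R \<and> y \<in> F}"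
  proof (rule approximable_mono, intro subsetI)
    fix x assume "x \<in> {z + v + orth_proj (orthogonal_comp V) y |v y. v \<in> V \<and> norm v \<le> R \<and> y \<in> F}"
    then obtain v y where x: "x = z + v + orth_proj (orthogonal_comp V) y" and v: "v \<in> V" "norm v \<le> R"
      and y: "y \<in> F" by blast
    define w where "w = v - orth_proj V y"
    have "w \<in> V" unfolding w_def using v(1) orth_proj_mem[OF V(1)] by (intro subspace_diff[OF V(1)])
    have "norm w \<le> R + D"
      using norm_triangle_ineq4[of v "orth_proj V y"] v(2) norm_orth_proj_le[OF V(1), of y] D[OF y]
      unfolding w_def by linarith
    then have a: "\<forall>b\<in>B. 0 \<le> M + coef w b \<and> M + coef w b \<le> 2 * M"
      using coef_bound by (smt (verit))
    have "x = y + (z + w)"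
      using orth_proj_add_orthogonal_comp[OF V(1), of y] unfolding x w_def by (simp add: algebra_simps)
    also have "z + w = (\<Sum>b\<in>B. (M + coef w b) *\<^sub>R b)"
      using coef_sum[OF \<open>w \<in> V\<close>] by (simp add: z_def scaleR_add_left sum.distrib)
    finally show "x \<in> {y + (\<Sum>b\<in>B. a b *\<^sub>R b) |y a. y \<in> F \<and> (\<forall>b\<in>B. 0 \<le> a b \<and> a b \<le> 2 * M)}"
      using y a by (intro CollectI exI[of _ y] exI[of _ "\<lambda>b. M + coef w b"]) simp
  qed
  then show thesis by (rule that)
qed

text \<open>An r-separated set \<open>D'\<close> in the ball of V times an r-separated set D in the
  projection is r-separated, and points of a magnified copy of F shadow it. The bound for F limits
  the product of the cardinalities; dividing by that of \<open>D'\<close>, at least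
  \<open>K * (R / r) ^ l\<close>, lowers the exponent by l. The unknown ratio k of g
  cancels.\<close>

lemma assouad_bound_projection:
  fixes S :: "(real^'n \<Rightarrow> real^'n) list"
  assumes ifs: "ifs S" and F: "attractor_of F S" and V: "subspace V" "V \<subseteq> overlap_space S F"
    and bound: "assouad_bound F s"
  shows "assouad_bound (orth_proj (orthogonal_comp V) ` F) (s - real (dim V))"
proof -
  define Q where "Q = orth_proj (orthogonal_comp V)"
  define l where "l = dim V"
  have Q_mem: "Q y \<in> orthogonal_comp V" for y
    unfolding Q_def by (rule orth_proj_mem[OF subspace_orthogonal_comp])
  obtain c where "0 \<le> s" and c: "\<And>r R x D. 0 < r \<Longrightarrow> r < R \<Longrightarrow> x \<in> F \<Longrightarrow> finite D \<Longrightarrow>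
      D \<subseteq> cball x R \<inter> F \<Longrightarrow> pairwise (\<lambda>x y. r \<le> dist x y) D \<Longrightarrow> real (card D) \<le> c * (R / r) powr s"
    using bound unfolding assouad_bound_iff_separated by blast
  obtain K where K: "0 < K" "\<And>r R. 0 < r \<Longrightarrow> r < R \<Longrightarrow> \<exists>D. finite D \<and> D \<subseteq> cball 0 R \<inter> V \<and>
      pairwise (\<lambda>x y. r \<le> dist x y) D \<and> K * (R / r) ^ l \<le> real (card D)"
    using subspace_separated[OF V(1)] unfolding l_def by blast
  \<comment> \<open>The 6 is the radius 3R divided by the separation \<open>r / 2\<close> of the
    shadowing points.\<close>
  define c' where "c' = c * 6 powr s / K"
  have main: "real (card D) \<le> c' * (R / r) powr (s - real l)"
    if r: "0 < r" "r < R" and x: "x \<in> Q ` F" and D: "finite D" "D \<subseteq> cball x R \<inter> Q ` F"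
      "pairwise (\<lambda>x y. r \<le> dist x y) D" for r R x D
  proof -
    have "0 < R" using r by simp
    obtain D' where D': "finite D'" "D' \<subseteq> cball 0 R \<inter> V" "pairwise (\<lambda>x y. r \<le> dist x y) D'"
      "K * (R / r) ^ l \<le> real (card D')"
      using K(2)[OF r] by blast
    obtain z where z: "approximable S F {z + v + Q y |v y. v \<in> V \<and> norm v \<le> R \<and> y \<in> F}"
      using approximable_product[OF ifs F V less_imp_le[OF \<open>0 < R\<close>]] unfolding Q_def by blast
    \<comment> \<open>Two errors of \<open>r / 8\<close> leave a separation of at least
      \<open>r / 2\<close> and keep all points within \<open>2 * R + r / 4\<close>, hence within 3R,
      of the centre.\<close>
    have "0 < r / 8" using r by simp
    then obtain g where g: "g \<in> ifs_maps S"
      "\<forall>p\<in>{z + v + Q y |v y. v \<in> V \<and> norm v \<le> R \<and> y \<in> F}. \<exists>x\<in>F. norm (inv g x - p) \<le> r / 8"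
      using z unfolding approximable_def by blast
    have near: "\<exists>x\<in>F. norm (inv g x - (z + v + y)) \<le> r / 8" if "v \<in> V" "norm v \<le> R" "y \<in> Q ` F" for v y
      using g(2) that by blast
    define pt where "pt p = (SOME x. x \<in> F \<and> norm (inv g x - (z + fst p + snd p)) \<le> r / 8)" for p
    have pt: "pt (v, y) \<in> F \<and> norm (inv g (pt (v, y)) - (z + v + y)) \<le> r / 8"
      if "v \<in> V" "norm v \<le> R" "y \<in> Q ` F" for v y
      unfolding pt_def using someI_ex[of "\<lambda>x. x \<in> F \<and> norm (inv g x - (z + v + y)) \<le> r / 8"] near[OF that]
      by auto
    obtain k T where kT: "similitude k T g" using ifs_maps_similitude[OF ifs g(1)] .
    have k: "0 < k" using kT by (simp add: similitude_def)
    have scale: "dist a b = k * dist (inv g a) (inv g b)" for a b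
      using similitude_norm[OF similitude_inv[OF kT], of a b] k by (simp add: dist_norm)
    have mem: "v \<in> V \<and> norm v \<le> R \<and> y \<in> Q ` F \<and> dist x y \<le> R" if "(v, y) \<in> D' \<times> D" for v y
      using that D' D by auto
    have sep: "k * (r / 2) \<le> dist (pt p) (pt p')" if "p \<in> D' \<times> D" "p' \<in> D' \<times> D" "p \<noteq> p'" for p p'
    proof -
      obtain v y v' y' where p: "p = (v, y)" "p' = (v', y')" by (metis surj_pair)
      have vy: "v \<in> V" "norm v \<le> R" "y \<in> Q ` F" "v' \<in> V" "norm v' \<le> R" "y' \<in> Q ` F"
        using mem that unfolding p by blast+
      have "v - v' \<in> V" using vy V(1) by (simp add: subspace_diff)
      moreover have "y - y' \<in> orthogonal_comp V"
        using vy Q_mem by (auto intro: subspace_diff[OF subspace_orthogonal_comp])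
      ultimately have "orthogonal (v - v') (y - y')" by (simp add: orthogonal_comp_def)
      then have pyth: "(norm ((v - v') + (y - y')))\<^sup>2 = (norm (v - v'))\<^sup>2 + (norm (y - y'))\<^sup>2"
        by (rule norm_add_Pythagorean)
      have "norm (v - v') \<le> norm ((v - v') + (y - y'))" "norm (y - y') \<le> norm ((v - v') + (y - y'))"
        by (rule power2_le_imp_le; simp add: pyth)+
      moreover have "r \<le> norm (v - v') \<or> r \<le> norm (y - y')"
        using that D(3) D'(3) unfolding p by (auto simp: pairwise_def dist_norm)
      ultimately have "r \<le> norm ((v - v') + (y - y'))" by linarith
      also have "(v - v') + (y - y') = (inv g (pt p) - inv g (pt p'))
          - (inv g (pt p) - (z + v + y)) + (inv g (pt p') - (z + v' + y'))"
        by (simp add: algebra_simps)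
      also have "norm \<dots> \<le> norm (inv g (pt p) - inv g (pt p'))
          + norm (inv g (pt p) - (z + v + y)) + norm (inv g (pt p') - (z + v' + y'))"
        by (rule norm_diff_add_le)
      also have "\<dots> \<le> dist (inv g (pt p)) (inv g (pt p')) + r / 8 + r / 8"
        using pt[OF vy(1-3)] pt[OF vy(4-6)] unfolding p dist_norm by (intro add_mono) simp_all
      finally have "r \<le> dist (inv g (pt p)) (inv g (pt p')) + r / 8 + r / 8" .
      then have "r / 2 \<le> dist (inv g (pt p)) (inv g (pt p'))" using r by linarith
      then show ?thesis unfolding scale[of "pt p"] using k by (intro mult_left_mono) auto
    qed
    have "inj_on pt (D' \<times> D)"
    proof (rule inj_onI, rule ccontr)
      fix p p' assume "p \<in> D' \<times> D" "p' \<in> D' \<times> D" "pt p = pt p'" "p \<noteq> p'"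
      then have "k * (r / 2) \<le> 0" using sep[of p p'] by simp
      moreover have "0 < k * (r / 2)" using k r by simp
      ultimately show False by linarith
    qed
    then have card: "card (pt ` (D' \<times> D)) = card D' * card D"
      by (simp add: card_image card_cartesian_product)
    have x0: "pt (0, x) \<in> F \<and> norm (inv g (pt (0, x)) - (z + 0 + x)) \<le> r / 8"
      using x V(1) \<open>0 < R\<close> by (intro pt) (auto simp: subspace_0)
    have "pt ` (D' \<times> D) \<subseteq> cball (pt (0, x)) (k * (3 * R)) \<inter> F"
    proof
      fix q assume "q \<in> pt ` (D' \<times> D)"
      then obtain v y where q: "q = pt (v, y)" and vy: "(v, y) \<in> D' \<times> D" by force
      note m = mem[OF vy]
      have "inv g (pt (0, x)) - inv g q = (inv g (pt (0, x)) - (z + 0 + x)) - (inv g q - (z + v + y))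
          + ((x - y) - v)"
        by (simp add: algebra_simps)
      also have "norm \<dots> \<le> r / 8 + r / 8 + (R + R)"
      proof (rule order_trans[OF norm_diff_add_le], intro add_mono)
        show "norm (x - y - v) \<le> R + R"
          using m norm_triangle_ineq4[of "x - y" v] unfolding dist_norm by linarith
      qed (use x0 m pt[of v y] q in simp_all)
      also have "\<dots> \<le> 3 * R" using r by simp
      finally have "dist (inv g (pt (0, x))) (inv g q) \<le> 3 * R" by (simp only: dist_norm)
      then have "dist (pt (0, x)) q \<le> k * (3 * R)"
        unfolding scale[of _ q] using k by (intro mult_left_mono) auto
      then show "q \<in> cball (pt (0, x)) (k * (3 * R)) \<inter> F" using pt[of v y] m q by auto
    qed
    moreover have "pairwise (\<lambda>x y. k * (r / 2) \<le> dist x y) (pt ` (D' \<times> D))"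
      unfolding pairwise_image using sep by (auto simp: pairwise_def)
    ultimately have "real (card (pt ` (D' \<times> D))) \<le> c * ((k * (3 * R)) / (k * (r / 2))) powr s"
      using k r x0 D(1) D'(1) by (intro c[of _ _ "pt (0, x)"] mult_strict_left_mono) auto
    also have "(k * (3 * R)) / (k * (r / 2)) = 6 * (R / r)" using k by simp
    also have "(6 * (R / r)) powr s = 6 powr s * (R / r) powr s" by (rule powr_mult)
    finally have "real (card D') * real (card D) \<le> c * 6 powr s * (R / r) powr s"
      unfolding card by simp
    moreover have "K * (R / r) ^ l * real (card D) \<le> real (card D') * real (card D)"
      using D'(4) by (intro mult_right_mono) auto
    ultimately have "K * (R / r) ^ l * real (card D) \<le> c * 6 powr s * (R / r) powr s" by linarith
    moreover have "(R / r) powr s = (R / r) powr (s - real l) * (R / r) ^ l"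
      using r by (simp add: powr_diff powr_realpow)
    ultimately have "K * (R / r) ^ l * real (card D) \<le> K * (R / r) ^ l * (c' * (R / r) powr (s - real l))"
      using K(1) by (simp add: c'_def mult_ac)
    moreover have "0 < K * (R / r) ^ l" using K(1) r by simp
    ultimately show ?thesis by (simp only: mult_le_cancel_left_pos)
  qed
  \<comment> \<open>Admissible exponents must be nonnegative. If s were below l, the bound for a
    single point at ratio t would read \<open>1 \<le> c' * t powr (s - real l)\<close>, whose right
    side tends to 0.\<close>
  have "real l \<le> s"
  proof (rule ccontr)
    assume "\<not> real l \<le> s"
    then have "((\<lambda>t. t powr (s - real l)) \<longlongrightarrow> 0) at_top"
      by (intro tendsto_neg_powr filterlim_ident) simp
    then have "((\<lambda>t. c' * t powr (s - real l)) \<longlongrightarrow> c' * 0) at_top"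
      by (intro tendsto_mult_left)
    then have "\<forall>\<^sub>F t in at_top. c' * t powr (s - real l) < 1"
      by (rule order_tendstoD) simp
    then have "\<forall>\<^sub>F t in at_top. c' * t powr (s - real l) < 1 \<and> 1 < t"
      using eventually_gt_at_top[of "1::real"] by eventually_elim simp
    then obtain t where t: "c' * t powr (s - real l) < 1" "1 < t"
      unfolding eventually_at_top_linorder by blast
    obtain x where "x \<in> Q ` F" using F by (auto simp: attractor_of_def)
    then have "real (card {x}) \<le> c' * (t / 1) powr (s - real l)"
      using t(2) by (intro main[of 1 t x]) auto
    then show False using t(1) by simp
  qed
  then have "0 \<le> s - real l" by simp
  then show ?thesis
    unfolding assouad_bound_iff_separated Q_def[symmetric] l_def[symmetric] using main by blast
qed

section \<open>Positivity of the dimension of projections\<close>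

text \<open>Compactness of the sphere: directions of width tending to 0 accumulate at a direction of
  width 0, and F would lie in a hyperplane orthogonal to it.\<close>

lemma width_bounded_below:
  fixes F :: "(real^'n) set"
  assumes "\<not> in_hyperplane F" "F \<noteq> {}"
  obtains w where "0 < w" "\<And>e. norm e = 1 \<Longrightarrow> \<exists>p\<in>F. \<exists>q\<in>F. w \<le> (p - q) \<bullet> e"
proof (rule ccontr)
  assume "\<not> thesis"
  then have "\<exists>e. norm e = 1 \<and> (\<forall>p\<in>F. \<forall>q\<in>F. (p - q) \<bullet> e < inverse (real (Suc k)))" for k
    using that[of "inverse (real (Suc k))"] by (meson inverse_positive_iff_positive not_le of_nat_0_less_iff zero_less_Suc)
  then obtain e where e: "\<And>k. norm (e k) = 1"
    "\<And>k p q. p \<in> F \<Longrightarrow> q \<in> F \<Longrightarrow> (p - q) \<bullet> e k < inverse (real (Suc k))" by metis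
  obtain e0 \<sigma> where e0: "norm e0 = 1" "strict_mono \<sigma>" "(e \<circ> \<sigma>) \<longlonglongrightarrow> e0"
    using compact_imp_seq_compact[OF compact_sphere[of "0::real^'n" 1]] e(1) unfolding seq_compact_def
    by (metis mem_sphere_0)
  have le: "(p - q) \<bullet> e0 \<le> 0" if "p \<in> F" "q \<in> F" for p q
  proof (rule LIMSEQ_le)
    show "(\<lambda>k. (p - q) \<bullet> e (\<sigma> k)) \<longlonglongrightarrow> (p - q) \<bullet> e0"
      using e0(3) by (intro tendsto_intros) (simp add: o_def)
    show "(\<lambda>k. inverse (real (Suc (\<sigma> k)))) \<longlonglongrightarrow> 0"
      using LIMSEQ_subseq_LIMSEQ[OF LIMSEQ_inverse_real_of_nat e0(2)] by (simp add: o_def)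
    show "\<exists>N. \<forall>k\<ge>N. (p - q) \<bullet> e (\<sigma> k) \<le> inverse (real (Suc (\<sigma> k)))"
      using e(2)[OF that] less_imp_le by blast
  qed
  obtain p where p: "p \<in> F" using assms(2) by blast
  have "F \<subseteq> {x. e0 \<bullet> x = e0 \<bullet> p}"
  proof
    fix x assume "x \<in> F"
    then show "x \<in> {x. e0 \<bullet> x = e0 \<bullet> p}"
      using le[of x p] le[of p x] p by (simp add: inner_diff_left inner_commute[of e0])
  qed
  moreover have "aff_dim {x. e0 \<bullet> x = e0 \<bullet> p} = int CARD('n) - 1"
    using e0(1) by (subst aff_dim_hyperplane) auto
  ultimately have "in_hyperplane F"
    unfolding in_hyperplane_def by (intro exI[of _ "{x. e0 \<bullet> x = e0 \<bullet> p}"]) (simp add: affine_hyperplane)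
  then show False using assms(1) by simp
qed

text \<open>The direction \<open>e\<close> is arbitrary inside the induction, since passing to a subcopy of \<open>F\<close>
  rotates it.\<close>

lemma separated_tree:
  fixes S :: "(real^'n \<Rightarrow> real^'n) list"
  assumes ifs: "ifs S" and F: "attractor_of F S" and nh: "\<not> in_hyperplane F"
  obtains \<kappa> \<theta> where "0 < \<kappa>" "\<kappa> < 1" "0 < \<theta>"
    "\<And>n e. norm e = 1 \<Longrightarrow> \<exists>D\<subseteq>F. finite D \<and> card D = 2 ^ n \<and>
       pairwise (\<lambda>x y. \<theta> * \<kappa> ^ n \<le> \<bar>(x - y) \<bullet> e\<bar>) D"
proof -
  have "F \<noteq> {}" and "bounded F" using F by (auto simp: attractor_of_def compact_imp_bounded)
  obtain w where w: "0 < w" "\<And>e. norm e = 1 \<Longrightarrow> \<exists>p\<in>F. \<exists>q\<in>F. w \<le> (p - q) \<bullet> e"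
    using width_bounded_below[OF nh \<open>F \<noteq> {}\<close>] by blast
  obtain M where M: "0 < M" "\<And>x y. x \<in> F \<Longrightarrow> y \<in> F \<Longrightarrow> norm (x - y) \<le> M"
    using bounded_norm_diff_le[OF \<open>bounded F\<close>] by blast
  \<comment> \<open>Two points of F differ by w along e. Subcopies around them stay within \<theta>
    = w / 3, by the choice of \<mu> from the diameter bound M, so a gap \<theta> remains between the
    two halves of the tree.\<close>
  define \<theta> where "\<theta> = w / 3"
  define \<mu> where "\<mu> = min (1 / 2) (\<theta> / M)"
  have \<theta>: "0 < \<theta>" using w by (simp add: \<theta>_def)
  have \<mu>: "0 < \<mu>" "\<mu> < 1" using \<theta> M(1) by (auto simp: \<mu>_def)
  have \<mu>M: "\<mu> * M \<le> \<theta>"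
  proof -
    have "\<mu> * M \<le> \<theta> / M * M" unfolding \<mu>_def using M(1) by (intro mult_right_mono) auto
    then show ?thesis using M(1) by simp
  qed
  obtain \<kappa> where \<kappa>: "0 < \<kappa>"
    "\<And>a. a \<in> F \<Longrightarrow> \<exists>g c Q. g \<in> ifs_maps S \<and> similitude c Q g \<and> a \<in> g ` F \<and> \<kappa> \<le> c \<and> c \<le> \<mu>"
    using ifs_maps_ratio[OF ifs F \<mu>(1)] by blast
  have "\<kappa> < 1" using \<kappa>(2) \<open>F \<noteq> {}\<close> \<mu>(2) by fastforce
  have branch: "\<exists>D\<subseteq>F. finite D \<and> card D = 2 ^ n \<and> pairwise (\<lambda>x y. \<theta> * \<kappa> ^ Suc n \<le> \<bar>(x - y) \<bullet> e\<bar>) D \<and>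
        (\<forall>x\<in>D. \<bar>(x - p) \<bullet> e\<bar> \<le> \<theta>)"
    if e: "norm e = 1" and p: "p \<in> F"
      and IH: "\<And>e::real^'n. norm e = 1 \<Longrightarrow> \<exists>D\<subseteq>F. finite D \<and> card D = 2 ^ n \<and>
        pairwise (\<lambda>x y. \<theta> * \<kappa> ^ n \<le> \<bar>(x - y) \<bullet> e\<bar>) D" for n e p
  proof -
    obtain g c Q where g: "g \<in> ifs_maps S" "similitude c Q g" "p \<in> g ` F" "\<kappa> \<le> c" "c \<le> \<mu>"
      using \<kappa>(2)[OF p] by blast
    have Q: "orthogonal_transformation Q" using g(2) by (simp add: similitude_def)
    \<comment> \<open>Separation of \<open>g(D)\<close> along e is c times separation of D along the
      rotated direction \<open>e'\<close>, to which the induction hypothesis applies.\<close>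
    obtain e' where e': "Q e' = e" using orthogonal_transformation_surj[OF Q] by (metis surjD)
    then have "norm e' = 1" using e orthogonal_transformation_norm[OF Q] by metis
    then obtain D where D: "D \<subseteq> F" "finite D" "card D = 2 ^ n"
      "pairwise (\<lambda>x y. \<theta> * \<kappa> ^ n \<le> \<bar>(x - y) \<bullet> e'\<bar>) D" using IH by blast
    have inner: "(g x - g y) \<bullet> e = c * ((x - y) \<bullet> e')" for x y
      using g(2) Q e' unfolding similitude_def orthogonal_transformation_def by (metis inner_scaleR_left)
    have sep: "pairwise (\<lambda>x y. \<theta> * \<kappa> ^ Suc n \<le> \<bar>(x - y) \<bullet> e\<bar>) (g ` D)"
      unfolding pairwise_image
    proof (rule pairwise_mono[OF D(4)], intro impI)
      fix x y assume "\<theta> * \<kappa> ^ n \<le> \<bar>(x - y) \<bullet> e'\<bar>"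
      then have "\<kappa> * (\<theta> * \<kappa> ^ n) \<le> c * \<bar>(x - y) \<bullet> e'\<bar>"
        using g(4) \<kappa>(1) \<theta> by (intro mult_mono) auto
      then show "\<theta> * \<kappa> ^ Suc n \<le> \<bar>(g x - g y) \<bullet> e\<bar>"
        using g(4) \<kappa>(1) by (simp add: inner abs_mult mult_ac)
    qed simp
    have near: "\<bar>(x - p) \<bullet> e\<bar> \<le> \<theta>" if x: "x \<in> g ` D" for x
    proof -
      obtain x' p' where xp: "x = g x'" "p = g p'" "x' \<in> F" "p' \<in> F" using x g(3) D(1) by blast
      have "\<bar>(x - p) \<bullet> e\<bar> \<le> norm (x - p) * norm e" by (rule Cauchy_Schwarz_ineq2)
      also have "\<dots> = c * norm (x' - p')" using e similitude_norm[OF g(2)] by (simp add: xp)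
      also have "\<dots> \<le> \<mu> * M" using g(4,5) \<kappa>(1) M(2)[OF xp(3,4)] \<mu> by (intro mult_mono) auto
      finally show ?thesis using \<mu>M by linarith
    qed
    have "inj_on g D" using similitude_bij[OF g(2)] by (meson bij_is_inj inj_on_subset subset_UNIV)
    then have "card (g ` D) = 2 ^ n" using D(3) by (simp add: card_image)
    moreover have "g ` D \<subseteq> F" using ifs_maps_image_subset[OF F g(1)] D(1) by blast
    ultimately show ?thesis using D(2) sep near by (intro exI[of _ "g ` D"]) auto
  qed
  have "\<exists>D\<subseteq>F. finite D \<and> card D = 2 ^ n \<and> pairwise (\<lambda>x y. \<theta> * \<kappa> ^ n \<le> \<bar>(x - y) \<bullet> e\<bar>) D"
    if "norm e = 1" for n and e :: "real^'n"
    using that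
  proof (induction n arbitrary: e)
    case 0
    obtain x where "x \<in> F" using \<open>F \<noteq> {}\<close> by blast
    then show ?case by (intro exI[of _ "{x}"]) auto
  next
    case (Suc n)
    obtain p q where pq: "p \<in> F" "q \<in> F" "w \<le> (p - q) \<bullet> e" using w(2)[OF Suc.prems] by blast
    obtain D1 where D1: "D1 \<subseteq> F" "finite D1" "card D1 = 2 ^ n"
      "pairwise (\<lambda>x y. \<theta> * \<kappa> ^ Suc n \<le> \<bar>(x - y) \<bullet> e\<bar>) D1" "\<And>x. x \<in> D1 \<Longrightarrow> \<bar>(x - p) \<bullet> e\<bar> \<le> \<theta>"
      using branch[OF Suc.prems pq(1) Suc.IH] by blast
    obtain D2 where D2: "D2 \<subseteq> F" "finite D2" "card D2 = 2 ^ n"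
      "pairwise (\<lambda>x y. \<theta> * \<kappa> ^ Suc n \<le> \<bar>(x - y) \<bullet> e\<bar>) D2" "\<And>x. x \<in> D2 \<Longrightarrow> \<bar>(x - q) \<bullet> e\<bar> \<le> \<theta>"
      using branch[OF Suc.prems pq(2) Suc.IH] by blast
    have "\<kappa> ^ Suc n \<le> 1" using \<kappa>(1) \<open>\<kappa> < 1\<close> by (intro power_le_one) auto
    then have "\<theta> * \<kappa> ^ Suc n \<le> \<theta> * 1" using \<theta> by (intro mult_left_mono) auto
    then have small: "\<theta> * \<kappa> ^ Suc n \<le> \<theta>" by simp
    have cross: "\<theta> \<le> (x - y) \<bullet> e" if "x \<in> D1" "y \<in> D2" for x y
      using D1(5)[OF that(1)] D2(5)[OF that(2)] pq(3) unfolding inner_diff_left \<theta>_def by linarith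
    have "D1 \<inter> D2 = {}" using cross \<theta> by force
    then have "card (D1 \<union> D2) = 2 ^ Suc n" using D1 D2 by (simp add: card_Un_disjoint)
    moreover have "pairwise (\<lambda>x y. \<theta> * \<kappa> ^ Suc n \<le> \<bar>(x - y) \<bullet> e\<bar>) (D1 \<union> D2)"
    proof -
      have "\<theta> * \<kappa> ^ Suc n \<le> \<bar>(x - y) \<bullet> e\<bar>" "\<theta> * \<kappa> ^ Suc n \<le> \<bar>(y - x) \<bullet> e\<bar>"
        if "x \<in> D1" "y \<in> D2" for x y
        using cross[OF that] small by (simp_all add: inner_diff_left)
      then show ?thesis using D1(4) D2(4) unfolding pairwise_def by blast
    qed
    ultimately show ?case using D1 D2 by (intro exI[of _ "D1 \<union> D2"]) auto
  qed
  then show thesis using that[OF \<kappa>(1) \<open>\<kappa> < 1\<close> \<theta>] by blast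
qed

text \<open>For a unit vector e of W, projecting to W preserves inner products with e, so the tree
  separated along e survives. Its \<open>2 ^ n\<close> points at scale
  \<open>\<theta> * \<kappa> ^ n\<close> rule out exponents below
  \<open>ln 2 / ln (1 / \<kappa>)\<close>.\<close>

lemma assouad_dim_projection_pos:
  fixes S :: "(real^'n \<Rightarrow> real^'n) list"
  assumes ifs: "ifs S" and F: "attractor_of F S" and nh: "\<not> in_hyperplane F"
    and W: "subspace W" "W \<noteq> {0}"
  shows "0 < assouad_dim (orth_proj W ` F)"
proof -
  obtain \<kappa> \<theta> where \<kappa>: "0 < \<kappa>" "\<kappa> < 1" "0 < \<theta>"
    and tree: "\<And>n e. norm e = 1 \<Longrightarrow> \<exists>D\<subseteq>F. finite D \<and> card D = 2 ^ n \<and>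
       pairwise (\<lambda>x y. \<theta> * \<kappa> ^ n \<le> \<bar>(x - y) \<bullet> e\<bar>) D"
    using separated_tree[OF ifs F nh] by blast
  obtain e0 where "e0 \<in> W" "e0 \<noteq> 0" using W subspace_0 by blast
  define e where "e = e0 /\<^sub>R norm e0"
  have e: "e \<in> W" "norm e = 1"
    using \<open>e0 \<in> W\<close> \<open>e0 \<noteq> 0\<close> W(1) by (auto simp: e_def subspace_scale)
  have inner: "(orth_proj W x - orth_proj W y) \<bullet> e = (x - y) \<bullet> e" for x y
    using orth_proj_orthogonal[OF W(1) e(1), of x] orth_proj_orthogonal[OF W(1) e(1), of y]
    by (simp add: orthogonal_def inner_diff_left)
  have "bounded (orth_proj W ` F)"
    using F by (simp add: attractor_of_def compact_imp_bounded bounded_linear_image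
      linear_orth_proj[OF W(1)] flip: linear_conv_bounded_linear)
  obtain x where x: "x \<in> orth_proj W ` F" using F by (auto simp: attractor_of_def)
  obtain R where R: "orth_proj W ` F \<subseteq> cball x R" "\<theta> < R"
  proof -
    obtain R0 where "orth_proj W ` F \<subseteq> cball x R0"
      using \<open>bounded (orth_proj W ` F)\<close> by (auto simp: bounded_any_center[where a = x] subset_iff)
    then have "orth_proj W ` F \<subseteq> cball x (max R0 (\<theta> + 1))" by (rule order_trans) (simp add: subset_cball)
    then show thesis using that[of "max R0 (\<theta> + 1)"] by simp
  qed
  define s0 where "s0 = ln 2 / ln (1 / \<kappa>)"
  have ln_pos: "0 < ln (1 / \<kappa>)" using \<kappa> by simp
  have "s0 \<le> s" if "assouad_bound (orth_proj W ` F) s" for s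
  proof (rule ccontr)
    assume "\<not> s0 \<le> s"
    obtain c where c: "\<And>r R x D. 0 < r \<Longrightarrow> r < R \<Longrightarrow> x \<in> orth_proj W ` F \<Longrightarrow> finite D \<Longrightarrow>
        D \<subseteq> cball x R \<inter> orth_proj W ` F \<Longrightarrow> pairwise (\<lambda>x y. r \<le> dist x y) D \<Longrightarrow>
        real (card D) \<le> c * (R / r) powr s"
      using \<open>assouad_bound (orth_proj W ` F) s\<close> unfolding assouad_bound_iff_separated by blast
    \<comment> \<open>Growth factor of the bound per level of the tree; \<open>s < s0\<close> says
      exactly that it is below the branching number 2.\<close>
    define q where "q = (1 / \<kappa>) powr s"
    have q: "0 < q" using \<kappa> by (simp add: q_def)
    have "s * ln (1 / \<kappa>) < ln 2" using \<open>\<not> s0 \<le> s\<close> ln_pos by (simp only: s0_def not_le pos_less_divide_eq)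
    then have "exp (s * ln (1 / \<kappa>)) < exp (ln 2)" by (simp only: exp_less_mono)
    then have "q < 2" using \<kappa> by (simp add: q_def powr_def)
    have growth: "2 ^ n \<le> c * (R / \<theta>) powr s * q ^ n" for n
    proof -
      obtain D where D: "D \<subseteq> F" "finite D" "card D = 2 ^ n"
        "pairwise (\<lambda>x y. \<theta> * \<kappa> ^ n \<le> \<bar>(x - y) \<bullet> e\<bar>) D"
        using tree[OF e(2)] by blast
      have pos: "0 < \<theta> * \<kappa> ^ n" using \<kappa> by simp
      have sep: "\<theta> * \<kappa> ^ n \<le> dist (orth_proj W y) (orth_proj W z)" if "y \<in> D" "z \<in> D" "y \<noteq> z" for y z
      proof -
        have "\<theta> * \<kappa> ^ n \<le> \<bar>(orth_proj W y - orth_proj W z) \<bullet> e\<bar>"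
          using D(4) that by (simp add: inner pairwise_def)
        also have "\<dots> \<le> norm (orth_proj W y - orth_proj W z) * norm e" by (rule Cauchy_Schwarz_ineq2)
        finally show ?thesis using e(2) by (simp add: dist_norm)
      qed
      have "inj_on (orth_proj W) D"
        using sep pos by (intro inj_onI) (metis dist_self not_le)
      then have "2 ^ n = real (card (orth_proj W ` D))" using D(3) by (simp add: card_image)
      also have "\<dots> \<le> c * (R / (\<theta> * \<kappa> ^ n)) powr s"
      proof (rule c[OF pos _ x])
        have "\<theta> * \<kappa> ^ n \<le> \<theta> * 1" using \<kappa> by (intro mult_left_mono power_le_one) auto
        then show "\<theta> * \<kappa> ^ n < R" using R(2) by simp
        show "finite (orth_proj W ` D)" using D(2) by simp
        show "orth_proj W ` D \<subseteq> cball x R \<inter> orth_proj W ` F" using D(1) R(1) by blast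
        show "pairwise (\<lambda>x y. \<theta> * \<kappa> ^ n \<le> dist x y) (orth_proj W ` D)"
          using sep by (auto simp: pairwise_def)
      qed
      also have "R / (\<theta> * \<kappa> ^ n) = (R / \<theta>) * (1 / \<kappa>) ^ n" by (simp add: power_one_over)
      also have "\<dots> powr s = (R / \<theta>) powr s * ((1 / \<kappa>) ^ n) powr s" by (rule powr_mult)
      also have "((1 / \<kappa>) ^ n) powr s = q ^ n"
        using \<kappa>(1) by (simp add: q_def powr_powr powr_power mult.commute flip: powr_realpow)
      finally show ?thesis by (simp only: mult.assoc)
    qed
    obtain n where n: "c * (R / \<theta>) powr s < (2 / q) ^ n"
      using real_arch_pow[of "2 / q"] \<open>q < 2\<close> q by auto
    then have "c * (R / \<theta>) powr s * q ^ n < 2 ^ n"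
      using q by (simp only: power_divide pos_less_divide_eq zero_less_power)
    then show False using growth[of n] by linarith
  qed
  then have "s0 \<le> assouad_dim (orth_proj W ` F)"
    unfolding assouad_dim_eq using assouad_bound_CARD by (intro cInf_greatest) auto
  moreover have "0 < s0" using ln_pos by (simp add: s0_def)
  ultimately show ?thesis by linarith
qed

lemma assouad_dim_eq_dim_add:
  fixes S :: "(real^'n \<Rightarrow> real^'n) list"
  assumes "ifs S" "attractor_of F S" "subspace V" "V \<subseteq> overlap_space S F"
  shows "assouad_dim F = real (dim V) + assouad_dim (orth_proj (orthogonal_comp V) ` F)"
proof (rule antisym)
  have "real (dim V) + assouad_dim (orth_proj (orthogonal_comp V) ` F) \<le> s" if "assouad_bound F s" for s
    using cInf_lower[OF _ bdd_below_assouad_bound, of "s - real (dim V)"]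
      assouad_bound_projection[OF assms that] unfolding assouad_dim_eq by fastforce
  then show "real (dim V) + assouad_dim (orth_proj (orthogonal_comp V) ` F) \<le> assouad_dim F"
    unfolding assouad_dim_eq[of F] using assouad_bound_CARD by (intro cInf_greatest) auto
qed (rule assouad_dim_le_dim_add[OF assms(3)])

theorem theorem1p4:
  fixes S :: "(real^'n \<Rightarrow> real^'n) list" and F :: "(real^'n) set"
  assumes "ifs S" and "attractor_of F S" and "\<not> in_hyperplane F"
  shows "(\<forall>V. subspace V \<and> V \<subseteq> overlap_space S F \<longrightarrow>
            assouad_dim F = real (dim V) + assouad_dim (orth_proj (orthogonal_comp V) ` F))
       \<and> assouad_dim F =
            real (overlap_dim F)
              + assouad_dim (orth_proj (orthogonal_comp (max_overlap_space F)) ` F)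
       \<and> (\<forall>V. subspace V \<and> V \<subseteq> overlap_space S F \<and> dim V < CARD('n) \<longrightarrow>
            real (dim V) < assouad_dim F)"
proof (intro conjI allI impI)
  fix V assume "subspace V \<and> V \<subseteq> overlap_space S F"
  then show "assouad_dim F = real (dim V) + assouad_dim (orth_proj (orthogonal_comp V) ` F)"
    using assouad_dim_eq_dim_add assms by blast
next
  define P where "P T \<longleftrightarrow> ifs T \<and> attractor_of F T" for T :: "(real^'n \<Rightarrow> real^'n) list"
  \<comment> \<open>The maximiser exists because S competes and dimensions are bounded. It is an IFS
    with attractor F, so the equality can be applied to it with V its whole overlap space.\<close>
  define T where "T = (ARG_MAX (\<lambda>T. dim (overlap_space T F)) T. P T)"
  have "dim (overlap_space T F) < Suc CARD('n)" for T :: "(real^'n \<Rightarrow> real^'n) list"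
    using dim_subset_UNIV[of "overlap_space T F"] by simp
  then have "P T"
    unfolding T_def using assms by (intro arg_max_natI[of P S _ "Suc CARD('n)"]) (auto simp: P_def)
  then have "assouad_dim F = real (dim (overlap_space T F))
      + assouad_dim (orth_proj (orthogonal_comp (overlap_space T F)) ` F)"
    using assouad_dim_eq_dim_add[OF _ _ subspace_overlap_space order_refl] unfolding P_def by blast
  then show "assouad_dim F = real (overlap_dim F)
      + assouad_dim (orth_proj (orthogonal_comp (max_overlap_space F)) ` F)"
    by (simp add: overlap_dim_def max_overlap_space_def T_def P_def)
next
  fix V assume V: "subspace V \<and> V \<subseteq> overlap_space S F \<and> dim V < CARD('n)"
  have "orthogonal_comp V \<noteq> {0}"
  proof
    assume "orthogonal_comp V = {0}"
    then have "V = UNIV" using V orthogonal_comp_self[of V] by simp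
    then show False using V by simp
  qed
  then have "0 < assouad_dim (orth_proj (orthogonal_comp V) ` F)"
    using assouad_dim_projection_pos[OF assms subspace_orthogonal_comp] by blast
  then show "real (dim V) < assouad_dim F"
    using assouad_dim_eq_dim_add[OF assms(1,2), of V] V by simp
qed

end
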